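(* Assume there is a Kurepa tree. Then there is an extraspecial $p$-group $G$ of cardinality $\omega_2$ such that $[G:A]\le\omega_1$ for every maximal abelian subgroup $A\le G$.
   Context: A tree is a partial order $(T,\le)$ such that for every $x\in T$ the set $\{y\in T: y<x\}$ is well-ordered by $<$; the height of $x$ is the order type of this set, the $\alpha$-th level $\mathrm{Lev}_\alpha(T)$ is the set of elements of height $\alpha$, the height of $T$ is the least $\alpha$ with $\mathrm{Lev}_\alpha(T)=\emptyset$, and a branch is a maximal totally ordered subset. A Kurepa tree is a tree of height $\omega_1$ with at least $\omega_2$ uncountable branches all of whose levels are countable. For a prime $p$, a $p$-group $E$ is extraspecial if its Frattini subgroup, its derived subgroup and its centre coincide and are cyclic of order $p$: $\Phi(E)=E'=Z(E)\cong\mathbb{Z}_p$. *)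

theory Defs
  imports
    "HOL-Library.Countable_Set"
    "HOL-Computational_Algebra.Primes"
    "HOL-Algebra.Elementary_Groups"
    "HOL-Algebra.Generated_Groups"
    "HOL-Algebra.Multiplicative_Group"
begin

unbundle cardinal_syntax

text \<open>Ordinals are well-order relations up to isomorphism (\<open>=o\<close>), compared by \<open>\<le>o\<close> and \<open><o\<close>.\<close>

abbreviation omega1 :: "nat set rel" where
  "omega1 \<equiv> cardSuc natLeq"

abbreviation omega2 :: "nat set set rel" where
  "omega2 \<equiv> cardSuc omega1"

text \<open>A tree is given by its reflexive order relation \<open>r\<close>; the underlying set is \<open>Field r\<close>,
  and \<open>underS r x\<close> is the set of strict predecessors of \<open>x\<close>.\<close>

definition is_tree :: "'a rel \<Rightarrow> bool" where
  "is_tree r \<longleftrightarrow> Partial_order r \<and> (\<forall>x\<in>Field r. Well_order (Restr r (underS r x)))"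

definition level :: "'a rel \<Rightarrow> 'b rel \<Rightarrow> 'a set" where
  "level r \<alpha> = {x \<in> Field r. Restr r (underS r x) =o \<alpha>}"

text \<open>It is enough to let \<open>\<beta>\<close> range over well-orders on the type of \<open>\<alpha>\<close>: every ordinal
  below \<open>\<alpha>\<close> is represented there, by an initial segment of \<open>\<alpha>\<close>.\<close>

definition has_height :: "'a rel \<Rightarrow> 'b rel \<Rightarrow> bool" where
  "has_height r \<alpha> \<longleftrightarrow>
     Well_order \<alpha> \<and> level r \<alpha> = {} \<and> (\<forall>\<beta> :: 'b rel. \<beta> <o \<alpha> \<longrightarrow> level r \<beta> \<noteq> {})"

definition branch :: "'a rel \<Rightarrow> 'a set \<Rightarrow> bool" where
  "branch r B \<longleftrightarrow> B \<in> Chains r \<and> (\<forall>C \<in> Chains r. B \<subseteq> C \<longrightarrow> C = B)"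

text \<open>In the clause on levels, well-orders on the type of the tree suffice: the height of
  each element of the tree is itself such a well-order, so all nonempty levels are covered.\<close>

definition kurepa_tree :: "'a rel \<Rightarrow> bool" where
  "kurepa_tree r \<longleftrightarrow>
     is_tree r \<and>
     has_height r omega1 \<and>
     (\<forall>\<alpha> :: 'a rel. Well_order \<alpha> \<longrightarrow> countable (level r \<alpha>)) \<and>
     omega2 \<le>o |{B. branch r B \<and> uncountable B}|"

definition p_group :: "nat \<Rightarrow> ('a, 'b) monoid_scheme \<Rightarrow> bool" where
  "p_group p G \<longleftrightarrow> group G \<and> (\<forall>x \<in> carrier G. \<exists>k. group.ord G x = p ^ k)"

definition centre :: "('a, 'b) monoid_scheme \<Rightarrow> 'a set" where
  "centre G = {z \<in> carrier G. \<forall>x \<in> carrier G. z \<otimes>\<^bsub>G\<^esub> x = x \<otimes>\<^bsub>G\<^esub> z}"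

definition maximal_subgroup :: "'a set \<Rightarrow> ('a, 'b) monoid_scheme \<Rightarrow> bool" where
  "maximal_subgroup M G \<longleftrightarrow>
     subgroup M G \<and> M \<noteq> carrier G \<and>
     (\<forall>K. subgroup K G \<longrightarrow> M \<subseteq> K \<longrightarrow> K = M \<or> K = carrier G)"

text \<open>If there are no maximal subgroups, the Frattini subgroup is the whole group.\<close>

definition frattini :: "('a, 'b) monoid_scheme \<Rightarrow> 'a set" where
  "frattini G = carrier G \<inter> \<Inter>{M. maximal_subgroup M G}"

definition extraspecial :: "nat \<Rightarrow> ('a, 'b) monoid_scheme \<Rightarrow> bool" where
  "extraspecial p G \<longleftrightarrow>
     prime p \<and> p_group p G \<and>
     frattini G = derived G (carrier G) \<and>
     derived G (carrier G) = centre G \<and>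
     G\<lparr>carrier := centre G\<rparr> \<cong> integer_mod_group p"

definition abelian_subgroup :: "'a set \<Rightarrow> ('a, 'b) monoid_scheme \<Rightarrow> bool" where
  "abelian_subgroup A G \<longleftrightarrow> subgroup A G \<and> comm_group (G\<lparr>carrier := A\<rparr>)"

definition maximal_abelian_subgroup :: "'a set \<Rightarrow> ('a, 'b) monoid_scheme \<Rightarrow> bool" where
  "maximal_abelian_subgroup A G \<longleftrightarrow>
     abelian_subgroup A G \<and> (\<forall>B. abelian_subgroup B G \<longrightarrow> A \<subseteq> B \<longrightarrow> B = A)"

end

theory Submission
  imports
    Defs
    "HOL-Library.Poly_Mapping"
    "HOL-Library.Product_Plus"
    "HOL-Algebra.Free_Abelian_Groups"
    "HOL-Number_Theory.Cong"
begin

text \<open>Let \<open>U\<close> be the vector space over the field with \<open>p\<close> elements on the basis \<open>\<omega>\<^sub>1\<close>, whose elements also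
  number the nodes of the tree, and let \<open>Y\<close> be spanned by \<open>\<omega>\<^sub>2\<close> uncountable branches together with all
  singletons, each acting on \<open>U\<close> as the indicator function of a set of nodes. Put on \<open>V = U \<oplus> Y\<close> the
  alternating form that is this action between \<open>Y\<close> and \<open>U\<close>, zero on \<open>Y\<close>, and on \<open>U\<close> is given by a
  colouring of pairs of countable ordinals that has no uncountable almost isotropic family. The
  group is the extension of \<open>V\<close> by the cyclic group of order \<open>p\<close> with this form as commutator;
  its maximal abelian subgroups correspond to the maximal isotropic subspaces \<open>S\<close>.

  If the projection of \<open>S\<close> to \<open>U\<close> is countable, its support lies below some \<open>\<delta> < \<omega>\<^sub>1\<close>; as the tree
  has countable levels, \<open>Y\<close> induces only countably many functions there, so that \<open>S\<close> has index at
  most \<open>\<omega>\<^sub>1\<close>. If the projection were uncountable, differences of elements of \<open>S\<close> would give a sequence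
  \<open>(u\<^sub>\<xi>, y\<^sub>\<xi>)\<close> with disjoint supports such that \<open>y\<^sub>\<xi>\<close> vanishes on \<open>u\<^sub>\<zeta>\<close> for \<open>\<zeta> < \<xi>\<close>, and \<open>y\<^sub>\<zeta>\<close> vanishes
  on \<open>u\<^sub>\<xi>\<close> for all but finitely many \<open>\<zeta> < \<xi>\<close>, since distinct branches are eventually disjoint; the
  \<open>u\<^sub>\<xi>\<close> would then be almost isotropic.\<close>

section \<open>Countable ordinals\<close>

lemma Well_order_omega1: "Well_order omega1"
  by (simp add: cardSuc_Well_order natLeq_Card_order)

lemma Card_order_omega1: "Card_order omega1"
  by (simp add: cardSuc_Card_order natLeq_Card_order)

lemma Card_order_omega2: "Card_order omega2"
  by (simp add: cardSuc_Card_order Card_order_omega1)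

typedef ord1 = "Field omega1"
  using Field_cardSuc_not_empty[OF natLeq_Card_order] by blast

typedef ord2 = "Field omega2"
  using Field_cardSuc_not_empty[OF Card_order_omega1] by blast

instantiation ord1 :: wellorder
begin

definition less_eq_ord1 :: "ord1 \<Rightarrow> ord1 \<Rightarrow> bool" where
  "less_eq_ord1 x y \<longleftrightarrow> (Rep_ord1 x, Rep_ord1 y) \<in> omega1"

definition less_ord1 :: "ord1 \<Rightarrow> ord1 \<Rightarrow> bool" where
  "less_ord1 x y \<longleftrightarrow> x \<le> y \<and> x \<noteq> y"

instance
proof
  note wo = Well_order_omega1[unfolded well_order_on_def linear_order_on_def
      partial_order_on_def preorder_on_def]
  fix x y z :: ord1
  show "x < y \<longleftrightarrow> x \<le> y \<and> \<not> y \<le> x"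
    using wo by (metis Rep_ord1_inject antisymD less_eq_ord1_def less_ord1_def)
  show "x \<le> x"
    using wo by (meson Rep_ord1 less_eq_ord1_def refl_onD)
  show "x \<le> y \<Longrightarrow> y \<le> z \<Longrightarrow> x \<le> z"
    using wo by (meson less_eq_ord1_def transD)
  show "x \<le> y \<Longrightarrow> y \<le> x \<Longrightarrow> x = y"
    using wo by (metis Rep_ord1_inject antisymD less_eq_ord1_def)
  show "x \<le> y \<or> y \<le> x"
    using wo Rep_ord1 unfolding less_eq_ord1_def total_on_def refl_on_def by metis
next
  fix P :: "ord1 \<Rightarrow> bool" and a :: ord1
  assume step: "\<And>x. (\<And>y. y < x \<Longrightarrow> P y) \<Longrightarrow> P x"
  have "wf (omega1 - Id)"
    using Well_order_omega1 by (simp add: well_order_on_def)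
  then have "wf (inv_image (omega1 - Id) Rep_ord1)"
    by (rule wf_inv_image)
  then show "P a"
    by (induction a) (rule step, simp add: less_ord1_def less_eq_ord1_def Rep_ord1_inject)
qed

end

lemma card_of_ord1: "|UNIV :: ord1 set| =o omega1"
proof -
  have "bij_betw Rep_ord1 UNIV (Field omega1)"
    using type_definition.Rep_range[OF type_definition_ord1]
    by (simp add: bij_betw_def inj_def Rep_ord1_inject)
  then have "|UNIV :: ord1 set| =o |Field omega1|"
    using card_of_ordIso by blast
  then show ?thesis
    using card_of_Field_ordIso[OF Card_order_omega1] ordIso_transitive by blast
qed

lemma card_of_ord2: "|UNIV :: ord2 set| =o omega2"
proof -
  have "bij_betw Rep_ord2 UNIV (Field omega2)"
    using type_definition.Rep_range[OF type_definition_ord2]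
    by (simp add: bij_betw_def inj_def Rep_ord2_inject)
  then have "|UNIV :: ord2 set| =o |Field omega2|"
    using card_of_ordIso by blast
  then show ?thesis
    using card_of_Field_ordIso[OF Card_order_omega2] ordIso_transitive by blast
qed

lemma countable_iff_ordLeq_natLeq: "countable A \<longleftrightarrow> |A| \<le>o natLeq"
proof -
  have "countable A \<longleftrightarrow> |A| \<le>o |UNIV :: nat set|"
    by (simp add: card_of_ordLeq[symmetric] countable_def)
  then show ?thesis
    using card_of_nat ordIso_symmetric ordLeq_ordIso_trans by blast
qed

lemma countable_iff_ordLess_omega1: "countable A \<longleftrightarrow> |A| <o omega1"
  using cardSuc_ordLess_ordLeq[OF natLeq_Card_order card_of_Card_order]
    cardSuc_ordLeq_ordLess[OF natLeq_Card_order card_of_Card_order]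
    countable_iff_ordLeq_natLeq by blast

lemma uncountable_ord1: "uncountable (UNIV :: ord1 set)"
  using countable_iff_ordLess_omega1 card_of_ord1 not_ordLess_ordIso by blast

lemma infinite_ord1: "infinite (UNIV :: ord1 set)"
  using countable_finite uncountable_ord1 by blast

lemma countable_lessThan_ord1 [simp]: "countable {..<x :: ord1}"
proof -
  have "Rep_ord1 ` {..<x} \<subseteq> underS omega1 (Rep_ord1 x)"
    by (auto simp: underS_def less_ord1_def less_eq_ord1_def Rep_ord1_inject)
  moreover have "countable (underS omega1 (Rep_ord1 x))"
    using card_of_underS[OF Card_order_omega1 Rep_ord1] countable_iff_ordLess_omega1 by blast
  ultimately have "countable (Rep_ord1 ` {..<x})"
    using countable_subset by blast
  then show ?thesis
    by (simp add: countable_image_inj_eq inj_on_def Rep_ord1_inject)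
qed

lemma countable_atMost_ord1 [simp]: "countable {..x :: ord1}"
  by (simp flip: ivl_disj_un_singleton(2))

text \<open>Regularity of \<open>omega1\<close>: the initial segments \<open>{..x}\<close> with
  \<open>x\<close> in \<open>X\<close> have countable union, so some \<open>b\<close> lies outside
  all of them.\<close>

lemma countable_bound_ord1:
  fixes X :: "ord1 set"
  assumes "countable X"
  obtains b where "\<And>x. x \<in> X \<Longrightarrow> x < b"
proof -
  have "countable (\<Union>x\<in>X. {..x})"
    using assms by simp
  then obtain b where "b \<notin> (\<Union>x\<in>X. {..x})"
    using uncountable_ord1 by (metis UNIV_eq_I)
  then show ?thesis
    by (intro that[of b]) (simp add: not_le)
qed

section \<open>Closure points and stationary sets\<close>

definition closure_point :: "(ord1 \<Rightarrow> ord1) \<Rightarrow> ord1 \<Rightarrow> bool" where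
  "closure_point g \<delta> \<longleftrightarrow> (\<exists>\<eta>. \<eta> < \<delta>) \<and> (\<forall>\<eta><\<delta>. g \<eta> < \<delta>)"

text \<open>The closure points of a function form a club, and every club contains such a set,
  so this is the usual notion of a stationary set.\<close>

definition stationary :: "ord1 set \<Rightarrow> bool" where
  "stationary S \<longleftrightarrow> (\<forall>g. \<exists>\<delta>\<in>S. closure_point g \<delta>)"

text \<open>Iterating from \<alpha> a function that dominates \<open>g\<close> on initial segments
  gives a sequence whose least strict upper bound is closed under \<open>g\<close>: everything below
  it is at most some iterate.\<close>

lemma closure_point_gt: "\<exists>\<delta>>\<alpha>. closure_point g \<delta>"
proof -
  have "\<exists>y. \<forall>\<eta>\<le>x. g \<eta> < y \<and> x < y" for x
  proof -
    have "countable (insert x (g ` {..x}))"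
      by simp
    then obtain b where "\<And>y. y \<in> insert x (g ` {..x}) \<Longrightarrow> y < b"
      using countable_bound_ord1 by blast
    then show ?thesis
      by auto
  qed
  then obtain h where h: "\<And>x \<eta>. \<eta> \<le> x \<Longrightarrow> g \<eta> < h x \<and> x < h x"
    by metis
  define s where "s n = (h ^^ n) \<alpha>" for n
  obtain b where "\<forall>n. s n < b"
    using countable_bound_ord1[of "range s"] by (metis countableI_type countable_image rangeI)
  define \<delta> where "\<delta> = (LEAST b. \<forall>n. s n < b)"
  have s: "s n < \<delta>" for n
    unfolding \<delta>_def using LeastI[of "\<lambda>b. \<forall>n. s n < b"] \<open>\<forall>n. s n < b\<close> by blast
  have "g \<eta> < \<delta>" if "\<eta> < \<delta>" for \<eta>
  proof -
    have "\<not> (\<forall>n. s n < \<eta>)"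
      using not_less_Least[of \<eta> "\<lambda>b. \<forall>n. s n < b"] that unfolding \<delta>_def by blast
    then obtain n where "\<eta> \<le> s n"
      by (meson not_le)
    then have "g \<eta> < s (Suc n)"
      by (simp add: s_def h)
    then show ?thesis
      using s less_trans by blast
  qed
  moreover have "\<alpha> < \<delta>"
    using s[of 0] by (simp add: s_def)
  ultimately show ?thesis
    unfolding closure_point_def by blast
qed

text \<open>A pointwise strict upper bound of all \<open>g n\<close> works. This replaces the
  closure of clubs under countable intersections.\<close>

lemma closure_point_common:
  fixes g :: "'n :: countable \<Rightarrow> ord1 \<Rightarrow> ord1"
  obtains h where "\<And>n \<delta>. closure_point h \<delta> \<Longrightarrow> closure_point (g n) \<delta>"
proof -
  have "\<exists>b. \<forall>n. g n \<eta> < b" for \<eta>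
    using countable_bound_ord1[of "range (\<lambda>n. g n \<eta>)"] by (metis countableI_type countable_image rangeI)
  then obtain h where "\<And>\<eta> n. g n \<eta> < h \<eta>"
    by metis
  then show ?thesis
    by (intro that[of h]) (auto simp: closure_point_def intro: less_trans)
qed

lemma stationary_mono: "stationary S \<Longrightarrow> S \<subseteq> T \<Longrightarrow> stationary T"
  unfolding stationary_def by blast

lemma stationary_unbounded:
  assumes "stationary S"
  obtains \<delta> where "\<delta> \<in> S" "closure_point g \<delta>" "\<alpha> < \<delta>"
proof -
  \<comment> \<open>The lower bound is coded as a function: \<delta> is a closure point of the
    constant \<alpha> exactly if \<alpha> < \<delta>.\<close>
  obtain h where h: "\<And>n \<delta>. closure_point h \<delta> \<Longrightarrow> closure_point (if n then g else (\<lambda>_. \<alpha>)) \<delta>"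
    using closure_point_common[of "\<lambda>n. if n then g else (\<lambda>_. \<alpha>)"] by blast
  obtain \<delta> where "\<delta> \<in> S" "closure_point h \<delta>"
    using assms unfolding stationary_def by blast
  with h[of \<delta> True] h[of \<delta> False] show ?thesis
    by (intro that[of \<delta>]) (auto simp: closure_point_def)
qed

lemma ex_enumerations:
  obtains e :: "ord1 \<Rightarrow> ord1 \<Rightarrow> nat" where "\<And>\<beta>. inj_on (e \<beta>) {..\<beta>}"
proof -
  have "\<exists>f :: ord1 \<Rightarrow> nat. inj_on f {..\<beta>}" for \<beta>
    using countable_atMost_ord1[of \<beta>] unfolding countable_def .
  then show ?thesis
    using that by metis
qed

text \<open>The rows of an Ulam matrix: for fixed \<open>n\<close> the sets \<open>{\<beta>. \<alpha> < \<beta> \<and> e \<beta> \<alpha> = n}\<close> are disjoint,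
  and for fixed \<open>\<alpha>\<close> countably many of them cover a final segment.\<close>

lemma stationary_partition:
  obtains q :: "ord1 \<Rightarrow> 'c :: countable" where "\<And>j. stationary {\<beta>. q \<beta> = j}"
proof -
  obtain e :: "ord1 \<Rightarrow> ord1 \<Rightarrow> nat" where e: "\<And>\<beta>. inj_on (e \<beta>) {..\<beta>}"
    using ex_enumerations by blast
  have "\<exists>n. stationary {\<beta>. \<alpha> < \<beta> \<and> e \<beta> \<alpha> = n}" for \<alpha>
  proof (rule ccontr)
    assume "\<nexists>n. stationary {\<beta>. \<alpha> < \<beta> \<and> e \<beta> \<alpha> = n}"
    then have "\<forall>n. \<exists>g. \<forall>\<delta>. \<alpha> < \<delta> \<longrightarrow> e \<delta> \<alpha> = n \<longrightarrow> \<not> closure_point g \<delta>"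
      unfolding stationary_def by blast
    then obtain g where g: "\<And>n \<delta>. \<alpha> < \<delta> \<Longrightarrow> e \<delta> \<alpha> = n \<Longrightarrow> \<not> closure_point (g n) \<delta>"
      by metis
    obtain h where h: "\<And>n \<delta>. closure_point h \<delta> \<Longrightarrow> closure_point (g n) \<delta>"
      using closure_point_common[of g] by blast
    obtain \<delta> where "\<alpha> < \<delta>" "closure_point h \<delta>"
      using closure_point_gt by blast
    then show False
      using g h by blast
  qed
  then obtain n where n: "\<And>\<alpha>. stationary {\<beta>. \<alpha> < \<beta> \<and> e \<beta> \<alpha> = n \<alpha>}"
    by metis
  have "\<exists>m. infinite {\<alpha>. n \<alpha> = m}"
  proof (rule ccontr)
    assume "\<nexists>m. infinite {\<alpha>. n \<alpha> = m}"
    then have "countable (\<Union>m. {\<alpha>. n \<alpha> = m})"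
      by (intro countable_UN) (auto intro: countable_finite)
    moreover have "(\<Union>m. {\<alpha>. n \<alpha> = m}) = UNIV"
      by blast
    ultimately show False
      using uncountable_ord1 by simp
  qed
  then obtain m where m: "infinite {\<alpha>. n \<alpha> = m}"
    by blast
  obtain f :: "nat \<Rightarrow> ord1" where f: "inj f" "range f \<subseteq> {\<alpha>. n \<alpha> = m}"
    using infinite_countable_subset[OF m] by blast
  define h :: "'c \<Rightarrow> ord1" where "h = f \<circ> to_nat"
  have h: "inj h" "\<And>j. n (h j) = m"
    using f by (auto simp: h_def inj_compose)
  \<comment> \<open>Injectivity of \<open>e \<beta>\<close> on \<open>{..\<beta>}\<close> makes
    \<open>j\<close> unique if it exists. Elsewhere \<open>q \<beta>\<close> is unspecified, which
    can only enlarge the fibres.\<close>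
  define q where "q \<beta> = (THE j. h j < \<beta> \<and> e \<beta> (h j) = m)" for \<beta>
  have "{\<beta>. h j < \<beta> \<and> e \<beta> (h j) = n (h j)} \<subseteq> {\<beta>. q \<beta> = j}" for j
  proof (safe, unfold q_def, rule the_equality)
    fix \<beta> i
    assume "h j < \<beta>" "e \<beta> (h j) = n (h j)" "h i < \<beta> \<and> e \<beta> (h i) = m"
    then have "h i = h j"
      using inj_onD[OF e[of \<beta>], of "h i" "h j"] h(2) by (simp add: less_imp_le)
    then show "i = j"
      using h(1) by (simp add: inj_eq)
  qed (use h in auto)
  then have "stationary {\<beta>. q \<beta> = j}" for j
    using n[of "h j"] stationary_mono by blast
  then show ?thesis
    using that by blast
qed

section \<open>Pigeonhole principles for uncountable sets\<close>

lemma uncountable_fibre: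
  assumes "uncountable A" "countable (f ` A)"
  obtains y where "uncountable {x \<in> A. f x = y}"
proof (rule ccontr)
  assume "\<not> thesis"
  then have "\<And>y. countable {x \<in> A. f x = y}"
    using that by blast
  then have "countable (\<Union>y\<in>f ` A. {x \<in> A. f x = y})"
    using assms(2) by blast
  moreover have "A \<subseteq> (\<Union>y\<in>f ` A. {x \<in> A. f x = y})"
    by blast
  ultimately show False
    using assms(1) countable_subset by blast
qed

text \<open>There are only countably many fibres, so the countable ones have countable union. This
  serves to discard points whose approximations are rare.\<close>

lemma countable_small_fibres:
  assumes "countable (f ` A)"
  shows "countable {x \<in> A. countable {y \<in> A. f y = f x}}"
proof -
  have "countable (\<Union>z\<in>{z \<in> f ` A. countable {y \<in> A. f y = z}}. {y \<in> A. f y = z})"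
    using assms by (intro countable_UN) auto
  then show ?thesis
    by (rule countable_subset[rotated]) auto
qed

lemma countable_finite_sets: "countable {X :: 'a :: countable set. finite X}"
  by (rule countable_Collect_finite)

lemma finite_bound_below:
  fixes \<delta> :: "'a :: linorder"
  assumes "finite F" "\<eta>0 < \<delta>"
  obtains \<eta> where "\<eta> < \<delta>" "\<And>x. x \<in> F \<Longrightarrow> x < \<delta> \<Longrightarrow> x \<le> \<eta>"
proof (rule that)
  have fin: "finite (insert \<eta>0 {x \<in> F. x < \<delta>})"
    using assms(1) by simp
  show "Max (insert \<eta>0 {x \<in> F. x < \<delta>}) < \<delta>"
    using fin assms(2) by (subst Max_less_iff) auto
  show "x \<le> Max (insert \<eta>0 {x \<in> F. x < \<delta>})" if "x \<in> F" "x < \<delta>" for x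
    using fin that by (intro Max_ge) auto
qed

section \<open>Bilinear forms on finitely supported functions\<close>

abbreviation (input) "keys \<equiv> Poly_Mapping.keys"

abbreviation (input) "lookup \<equiv> Poly_Mapping.lookup"

text \<open>Vectors over the field with \<open>p\<close> elements are represented by integer
  coefficients; reduction modulo \<open>p\<close> enters through divisibility of values and through
  \<open>red\<close>.\<close>

definition lin :: "('i \<Rightarrow> int) \<Rightarrow> ('i \<Rightarrow>\<^sub>0 int) \<Rightarrow> int" where
  "lin f v = (\<Sum>i\<in>keys v. lookup v i * f i)"

definition bil :: "('i \<Rightarrow> 'j \<Rightarrow> int) \<Rightarrow> ('i \<Rightarrow>\<^sub>0 int) \<Rightarrow> ('j \<Rightarrow>\<^sub>0 int) \<Rightarrow> int" where
  "bil b v w = lin (\<lambda>i. lin (b i) w) v"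

lemma lin_superset:
  assumes "finite X" "keys v \<subseteq> X"
  shows "lin f v = (\<Sum>i\<in>X. lookup v i * f i)"
  unfolding lin_def using assms by (intro sum.mono_neutral_left) (auto simp: in_keys_iff)

lemma lin_add: "lin f (v + w) = lin f v + lin f w"
proof -
  let ?X = "keys v \<union> keys w"
  have "keys (v + w) \<subseteq> ?X"
    by (rule Poly_Mapping.keys_add)
  then show ?thesis
    by (simp add: lin_superset[of ?X] lookup_add algebra_simps sum.distrib)
qed

lemma lin_zero [simp]: "lin f 0 = 0"
  by (simp add: lin_def)

lemma lin_diff: "lin f (v - w) = lin f v - lin f w"
  using lin_add[of f "v - w" w] by simp

lemma lin_single [simp]: "lin f (Poly_Mapping.single i a) = a * f i"
  by (simp add: lin_superset[of "{i}"])

lemma lin_fun_add: "lin (\<lambda>i. f i + g i) v = lin f v + lin g v"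
  by (simp add: lin_def algebra_simps sum.distrib)

lemma lin_fun_diff: "lin (\<lambda>i. f i - g i) v = lin f v - lin g v"
  by (simp add: lin_def algebra_simps sum_subtractf)

lemma lin_fun_zero [simp]: "lin (\<lambda>i. 0) v = 0"
  by (simp add: lin_def)

lemma lin_cong: "(\<And>i. i \<in> keys v \<Longrightarrow> f i = g i) \<Longrightarrow> lin f v = lin g v"
  by (simp add: lin_def)

lemma bil_add_left: "bil b (v + v') w = bil b v w + bil b v' w"
  by (simp add: bil_def lin_add)

lemma bil_add_right: "bil b v (w + w') = bil b v w + bil b v w'"
  by (simp add: bil_def lin_add lin_fun_add)

lemma bil_diff_left: "bil b (v - v') w = bil b v w - bil b v' w"
  by (simp add: bil_def lin_diff)

lemma bil_diff_right: "bil b v (w - w') = bil b v w - bil b v w'"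
  by (simp add: bil_def lin_diff lin_fun_diff)

lemma bil_zero [simp]: "bil b 0 w = 0" "bil b v 0 = 0"
  by (simp_all add: bil_def)

lemma bil_eq_0:
  assumes "\<And>i j. i \<in> keys v \<Longrightarrow> j \<in> keys w \<Longrightarrow> b i j = 0"
  shows "bil b v w = 0"
  unfolding bil_def lin_def using assms by simp

section \<open>A colouring of pairs of countable ordinals\<close>

definition prefix :: "nat \<Rightarrow> (nat \<Rightarrow> bool) \<Rightarrow> bool list" where
  "prefix n x = map x [0..<n]"

text \<open>For distinct sequences this is the length of the longest common prefix; for equal ones
  it is unspecified.\<close>

definition split :: "(nat \<Rightarrow> bool) \<Rightarrow> (nat \<Rightarrow> bool) \<Rightarrow> nat" where
  "split x y = (LEAST n. x n \<noteq> y n)"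

lemma length_prefix [simp]: "length (prefix n x) = n"
  by (simp add: prefix_def)

lemma prefix_eq_iff: "prefix n x = prefix n y \<longleftrightarrow> (\<forall>i<n. x i = y i)"
  by (auto simp: prefix_def)

lemma prefix_mono: "prefix n x = prefix n y \<Longrightarrow> k \<le> n \<Longrightarrow> prefix k x = prefix k y"
  by (simp add: prefix_eq_iff)

lemma prefix_eq_iff_split:
  assumes "x \<noteq> y"
  shows "prefix n x = prefix n y \<longleftrightarrow> n \<le> split x y"
proof -
  have "\<exists>i. x i \<noteq> y i"
    using assms by (simp add: fun_eq_iff)
  then have "x (split x y) \<noteq> y (split x y)"
    unfolding split_def by (rule LeastI_ex)
  moreover have "x i = y i" if "i < split x y" for i
    using not_less_Least that unfolding split_def by blast
  ultimately show ?thesis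
    unfolding prefix_eq_iff by (metis linorder_not_le order_less_le_trans[of _ n])
qed

text \<open>Prefixes that differ already contain the first disagreement and so determine where it
  occurs.\<close>

lemma split_cong:
  assumes "prefix n x = prefix n x'" "prefix n y = prefix n y'" "prefix n x \<noteq> prefix n y"
  shows "split x y = split x' y'"
proof -
  have xy: "x \<noteq> y" "x' \<noteq> y'"
    using assms by auto
  have "k \<le> split x y \<longleftrightarrow> k \<le> split x' y'" for k
  proof (cases "k \<le> n")
    case True
    then have "prefix k x = prefix k x'" "prefix k y = prefix k y'"
      using assms prefix_mono by blast+
    then show ?thesis
      using xy by (simp flip: prefix_eq_iff_split)
  next
    case False
    then have "prefix k x \<noteq> prefix k y" "prefix k x' \<noteq> prefix k y'"
      using assms prefix_mono[of k x y n] prefix_mono[of k x' y' n]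
      by (auto dest: prefix_mono)
    then show ?thesis
      using xy by (simp flip: prefix_eq_iff_split)
  qed
  from this[of "split x y"] this[of "split x' y'"] show ?thesis
    by simp
qed

text \<open>The bracket of \<open>\<alpha> < \<beta>\<close> at resolution \<open>n\<close> is the first ordinal \<open>\<ge> \<alpha>\<close> among the finitely many that
  have number at most \<open>n\<close> in the enumeration of \<open>{..\<beta>}\<close>. If \<open>n\<close> is at least the number of \<open>\<delta>\<close>, it
  takes the value \<open>\<delta>\<close> for all \<open>\<alpha>\<close> close enough below \<open>\<delta>\<close>; this is how the value \<open>q \<delta>\<close> is realised as a
  colour.\<close>

locale colouring =
  fixes r :: "ord1 \<Rightarrow> nat \<Rightarrow> bool"
    and e :: "ord1 \<Rightarrow> ord1 \<Rightarrow> nat"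
    and q :: "ord1 \<Rightarrow> bool list option"
  assumes inj_r: "inj r"
    and inj_e: "inj_on (e \<beta>) {..\<beta>}"
    and stationary_q: "stationary {\<beta>. q \<beta> = j}"
begin

text \<open>Including \<beta> itself gives every \<alpha> \<le> \<beta> a mark at or above it, so
  the minimum in \<open>bracket\<close> exists.\<close>

definition marks :: "nat \<Rightarrow> ord1 \<Rightarrow> ord1 set" where
  "marks n \<beta> = insert \<beta> {\<eta>. \<eta> \<le> \<beta> \<and> e \<beta> \<eta> \<le> n}"

definition bracket :: "nat \<Rightarrow> ord1 \<Rightarrow> ord1 \<Rightarrow> ord1" where
  "bracket n \<alpha> \<beta> = (LEAST \<eta>. \<eta> \<in> marks n \<beta> \<and> \<alpha> \<le> \<eta>)"

definition code :: "ord1 \<Rightarrow> ord1 \<Rightarrow> ord1 \<Rightarrow> int" where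
  "code \<xi> \<alpha> \<beta> =
     of_bool (\<exists>\<sigma>. q \<xi> = Some \<sigma> \<and> prefix (length \<sigma>) (r \<alpha>) = \<sigma> \<and> prefix (length \<sigma>) (r \<beta>) = \<sigma>)"

definition colour :: "ord1 \<Rightarrow> ord1 \<Rightarrow> int" where
  "colour \<alpha> \<beta> =
     (if \<alpha> < \<beta> then code (bracket (split (r \<alpha>) (r \<beta>)) \<alpha> \<beta>) \<alpha> \<beta> else 0)"

lemma finite_marks [simp]: "finite (marks n \<beta>)"
proof -
  have "inj_on (e \<beta>) {\<eta>. \<eta> \<le> \<beta> \<and> e \<beta> \<eta> \<le> n}"
    by (rule inj_on_subset[OF inj_e]) auto
  moreover have "finite (e \<beta> ` {\<eta>. \<eta> \<le> \<beta> \<and> e \<beta> \<eta> \<le> n})"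
    by (rule finite_subset[of _ "{..n}"]) auto
  ultimately show ?thesis
    unfolding marks_def using finite_imageD by blast
qed

lemma bracket_shift:
  assumes "\<alpha> \<le> \<delta>" "\<And>\<eta>. \<eta> \<in> marks n \<beta> \<Longrightarrow> \<eta> < \<delta> \<Longrightarrow> \<eta> < \<alpha>"
  shows "bracket n \<alpha> \<beta> = bracket n \<delta> \<beta>"
proof -
  have "\<eta> \<in> marks n \<beta> \<and> \<alpha> \<le> \<eta> \<longleftrightarrow> \<eta> \<in> marks n \<beta> \<and> \<delta> \<le> \<eta>" for \<eta>
    using assms(1) assms(2)[of \<eta>] by (meson leD leI order_trans)
  then show ?thesis
    unfolding bracket_def by simp
qed

lemma bracket_mark: "\<delta> \<in> marks n \<beta> \<Longrightarrow> bracket n \<delta> \<beta> = \<delta>"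
  unfolding bracket_def by (rule Least_equality) auto

text \<open>Strings of length at most \<open>m\<close> do not distinguish \<alpha> from \<alpha>';
  longer ones cannot be a common prefix with \<beta>.\<close>

lemma code_off_diagonal:
  assumes "prefix m (r \<alpha>) = prefix m (r \<alpha>')" "prefix m (r \<alpha>) \<noteq> prefix m (r \<beta>)"
  shows "code \<xi> \<alpha> \<beta> = code \<xi> \<alpha>' \<beta>"
proof -
  have "prefix (length \<sigma>) (r \<alpha>) = \<sigma> \<and> prefix (length \<sigma>) (r \<beta>) = \<sigma> \<longleftrightarrow>
    prefix (length \<sigma>) (r \<alpha>') = \<sigma> \<and> prefix (length \<sigma>) (r \<beta>) = \<sigma>" for \<sigma>
  proof (cases "length \<sigma> \<le> m")
    case True
    then show ?thesis
      using prefix_mono[OF assms(1) True] by simp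
  next
    case False
    then show ?thesis
      using assms prefix_mono[of "length \<sigma>" "r \<alpha>" "r \<beta>" m] prefix_mono[of "length \<sigma>" "r \<alpha>'" "r \<beta>" m]
      by auto
  qed
  then show ?thesis
    unfolding code_def by simp
qed

text \<open>With \<open>\<xi>\<close> fixed, two elements \<open>u \<zeta>\<close> and \<open>u \<zeta>'\<close> of the family are chosen just below \<open>\<delta> < \<delta>' < \<xi>\<close>,
  looking alike except that corresponding points of \<open>u \<zeta>\<close> and \<open>u \<xi>\<close> have bracket \<open>\<delta>\<close>, those of \<open>u \<zeta>'\<close>
  and \<open>u \<xi>\<close> bracket \<open>\<delta>'\<close>. As \<open>q \<delta>\<close> singles out one point of the support and \<open>q \<delta>'\<close> none, the two
  values of the form differ by the square of one coefficient.\<close>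

lemma colour_not_almost_null:
  fixes u :: "ord1 \<Rightarrow> (ord1 \<Rightarrow>\<^sub>0 int)" and p :: nat
  assumes "prime p"
    and nonempty: "\<And>\<xi>. keys (u \<xi>) \<noteq> {}"
    and above: "\<And>\<xi> \<gamma>. \<gamma> \<in> keys (u \<xi>) \<Longrightarrow> \<xi> \<le> \<gamma>"
    and coprime: "\<And>\<xi> \<gamma>. \<gamma> \<in> keys (u \<xi>) \<Longrightarrow> \<not> int p dvd lookup (u \<xi>) \<gamma>"
  shows "\<exists>\<xi>. infinite {\<zeta>. (\<forall>\<gamma>\<in>keys (u \<zeta>). \<forall>\<gamma>'\<in>keys (u \<xi>). \<gamma> < \<gamma>') \<and> \<not> int p dvd bil colour (u \<zeta>) (u \<xi>)}"
proof -
  have "\<exists>m. inj_on (\<lambda>\<gamma>. prefix m (r \<gamma>)) (keys (u \<xi>))" for \<xi>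
  proof -
    define m where "m = Suc (Max ((\<lambda>(\<alpha>, \<beta>). split (r \<alpha>) (r \<beta>)) ` (keys (u \<xi>) \<times> keys (u \<xi>))))"
    have "inj_on (\<lambda>\<gamma>. prefix m (r \<gamma>)) (keys (u \<xi>))"
    proof (rule inj_onI, rule ccontr)
      fix \<alpha> \<beta>
      assume *: "\<alpha> \<in> keys (u \<xi>)" "\<beta> \<in> keys (u \<xi>)" "prefix m (r \<alpha>) = prefix m (r \<beta>)" "\<alpha> \<noteq> \<beta>"
      then have "m \<le> split (r \<alpha>) (r \<beta>)"
        using inj_r by (simp add: inj_eq prefix_eq_iff_split)
      moreover have "split (r \<alpha>) (r \<beta>) < m"
        unfolding m_def less_Suc_eq_le using * by (intro Max_ge) force+
      ultimately show False
        by simp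
    qed
    then show ?thesis
      by blast
  qed
  then obtain len where len: "\<And>\<xi>. inj_on (\<lambda>\<gamma>. prefix (len \<xi>) (r \<gamma>)) (keys (u \<xi>))"
    by metis
  \<comment> \<open>There are only countably many shapes, so uncountably many \<open>u \<xi>\<close>
    agree in the prefixes of their support points and in the coefficients attached to them.\<close>
  define shape where "shape \<xi> = (len \<xi>, (\<lambda>\<gamma>. (prefix (len \<xi>) (r \<gamma>), lookup (u \<xi>) \<gamma>)) ` keys (u \<xi>))" for \<xi>
  have "countable (range shape)"
    by (rule countable_subset[of _ "UNIV \<times> {X. finite X}"])
      (auto simp: shape_def countable_finite_sets)
  then obtain s where "uncountable {\<xi> \<in> UNIV. shape \<xi> = s}"
    using uncountable_fibre[OF uncountable_ord1] by blast
  then obtain m F where X: "uncountable {\<xi>. shape \<xi> = (m, F)}"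
    by (cases s) auto
  define X where "X = {\<xi>. shape \<xi> = (m, F)}"
  define T where "T = fst ` F"
  have "X \<noteq> {}"
    using X X_def by force
  \<comment> \<open>Within \<open>X\<close> the common set \<open>T\<close> of prefixes indexes
    every support.\<close>
  define pos where "pos \<xi> t = (THE \<gamma>. \<gamma> \<in> keys (u \<xi>) \<and> prefix m (r \<gamma>) = t)" for \<xi> t
  have T: "T = (\<lambda>\<gamma>. prefix m (r \<gamma>)) ` keys (u \<xi>)" if "\<xi> \<in> X" for \<xi>
    using that unfolding X_def T_def shape_def by (auto simp: image_image)
  have pos: "pos \<xi> t \<in> keys (u \<xi>)" "prefix m (r (pos \<xi> t)) = t" if "\<xi> \<in> X" "t \<in> T" for \<xi> t
  proof -
    have "inj_on (\<lambda>\<gamma>. prefix m (r \<gamma>)) (keys (u \<xi>))"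
      using len[of \<xi>] that(1) by (simp add: X_def shape_def)
    then have "\<exists>!\<gamma>. \<gamma> \<in> keys (u \<xi>) \<and> prefix m (r \<gamma>) = t"
      using that(2) unfolding T[OF that(1)] by (auto dest: inj_onD)
    from theI'[OF this] show "pos \<xi> t \<in> keys (u \<xi>)" "prefix m (r (pos \<xi> t)) = t"
      unfolding pos_def by blast+
  qed
  have keys: "keys (u \<xi>) = pos \<xi> ` T" if "\<xi> \<in> X" for \<xi>
  proof (intro equalityI subsetI)
    fix \<gamma> assume \<gamma>: "\<gamma> \<in> keys (u \<xi>)"
    have "inj_on (\<lambda>\<gamma>. prefix m (r \<gamma>)) (keys (u \<xi>))"
      using len[of \<xi>] that(1) by (simp add: X_def shape_def)
    moreover have t: "prefix m (r \<gamma>) \<in> T"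
      unfolding T[OF that] using \<gamma> by blast
    ultimately have "\<gamma> = pos \<xi> (prefix m (r \<gamma>))"
      using \<gamma> pos[OF that t] by (auto dest: inj_onD)
    then show "\<gamma> \<in> pos \<xi> ` T"
      using t by blast
  qed (use pos that in blast)
  have inj_pos: "inj_on (pos \<xi>) T" if "\<xi> \<in> X" for \<xi>
    using pos(2)[OF that] by (metis inj_onI)
  have "finite T"
    using T \<open>X \<noteq> {}\<close> by fastforce
  have "T \<noteq> {}"
    using T \<open>X \<noteq> {}\<close> nonempty by fastforce
  then obtain t0 where "t0 \<in> T"
    by blast
  have "\<exists>d. \<forall>\<xi>\<in>X. \<forall>t\<in>T. lookup (u \<xi>) (pos \<xi> t) = d t"
  proof -
    obtain \<xi>0 where "\<xi>0 \<in> X"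
      using \<open>X \<noteq> {}\<close> by blast
    have "lookup (u \<xi>) (pos \<xi> t) = lookup (u \<xi>0) (pos \<xi>0 t)" if "\<xi> \<in> X" "t \<in> T" for \<xi> t
    proof -
      have F: "F = (\<lambda>\<gamma>. (prefix m (r \<gamma>), lookup (u \<xi>) \<gamma>)) ` keys (u \<xi>)" if "\<xi> \<in> X" for \<xi>
        using that unfolding X_def shape_def by auto
      have "(t, lookup (u \<xi>0) (pos \<xi>0 t)) \<in> F"
        unfolding F[OF \<open>\<xi>0 \<in> X\<close>] using pos[OF \<open>\<xi>0 \<in> X\<close> that(2)] by force
      then obtain \<gamma> where "\<gamma> \<in> keys (u \<xi>)" "prefix m (r \<gamma>) = t" "lookup (u \<xi>) \<gamma> = lookup (u \<xi>0) (pos \<xi>0 t)"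
        unfolding F[OF \<open>\<xi> \<in> X\<close>] by auto
      moreover have "inj_on (\<lambda>\<gamma>. prefix m (r \<gamma>)) (keys (u \<xi>))"
        using len[of \<xi>] that(1) by (simp add: X_def shape_def)
      ultimately show ?thesis
        using pos[OF that] by (auto dest: inj_onD)
    qed
    then show ?thesis
      by (intro exI[of _ "\<lambda>t. lookup (u \<xi>0) (pos \<xi>0 t)"]) blast
  qed
  then obtain d where d: "\<And>\<xi> t. \<xi> \<in> X \<Longrightarrow> t \<in> T \<Longrightarrow> lookup (u \<xi>) (pos \<xi> t) = d t"
    by blast
  have lin_u: "lin f (u \<xi>) = (\<Sum>t\<in>T. d t * f (pos \<xi> t))" if "\<xi> \<in> X" for f \<xi>
    unfolding lin_def keys[OF that] sum.reindex[OF inj_pos[OF that]] using d[OF that] by simp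
  have bil_u: "bil colour (u \<zeta>) (u \<xi>) = (\<Sum>s\<in>T. \<Sum>t\<in>T. d s * d t * colour (pos \<zeta> s) (pos \<xi> t))"
    if "\<zeta> \<in> X" "\<xi> \<in> X" for \<zeta> \<xi>
    unfolding bil_def using that by (simp add: lin_u sum_distrib_left mult.assoc)

  \<comment> \<open>A kind records a support to a finer precision \<open>K\<close>, tagged by the
    index \<open>t\<close>. For fixed \<open>K\<close> only countably many kinds occur, so passing
    to \<open>X'\<close> loses only countably many elements.\<close>
  define kind where "kind K \<xi> = (\<lambda>t. (t, prefix K (r (pos \<xi> t)))) ` T" for K \<xi>
  have kindD: "prefix K (r (pos \<xi> t)) = prefix K (r (pos \<zeta> t))"
    if "kind K \<xi> = kind K \<zeta>" "t \<in> T" for K \<xi> \<zeta> t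
  proof -
    have "(t, prefix K (r (pos \<xi> t))) \<in> kind K \<zeta>"
      using that unfolding that(1)[symmetric] by (auto simp: kind_def)
    then show ?thesis
      by (auto simp: kind_def)
  qed
  have countable_kinds: "countable (kind K ` X)" for K
    by (rule countable_subset[OF _ countable_finite_sets]) (auto simp: kind_def \<open>finite T\<close>)
  define X' where "X' = {\<xi> \<in> X. \<forall>K. uncountable {\<zeta> \<in> X. kind K \<zeta> = kind K \<xi>}}"
  have "countable (\<Union>K. {\<xi> \<in> X. countable {\<zeta> \<in> X. kind K \<zeta> = kind K \<xi>}})"
    using countable_small_fibres[OF countable_kinds] by blast
  then have "countable (X - X')"
    by (rule countable_subset[rotated]) (auto simp: X'_def)
  have X'_large: "\<exists>\<xi>\<in>Y \<inter> X'. b < \<xi>" if "uncountable Y" "Y \<subseteq> X" for Y b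
  proof (rule ccontr)
    assume "\<not> (\<exists>\<xi>\<in>Y \<inter> X'. b < \<xi>)"
    then have "Y \<subseteq> (X - X') \<union> {..b}"
      using that(2) by (force simp: not_less)
    then show False
      using that(1) \<open>countable (X - X')\<close> by (meson countable_Un countable_atMost_ord1 countable_subset)
  qed

  \<comment> \<open>As there are countably many pairs \<open>(K, \<tau>)\<close>, one bound
    \<open>b\<close> serves all kinds that occur uncountably often. Below a closure point of the
    resulting \<open>g\<close>, each such kind is realised beyond any given \<eta>.\<close>
  define reach where "reach \<eta> b \<longleftrightarrow> (\<forall>K \<tau>. finite \<tau> \<longrightarrow> uncountable {\<zeta> \<in> X. kind K \<zeta> = \<tau>} \<longrightarrow>
    (\<exists>\<zeta>\<in>X. kind K \<zeta> = \<tau> \<and> (\<forall>t\<in>T. \<eta> < pos \<zeta> t \<and> pos \<zeta> t < b)))" for \<eta> b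
  have "\<exists>b. reach \<eta> b" for \<eta>
  proof -
    define good where "good c b \<longleftrightarrow> (\<exists>\<zeta>\<in>X. kind (fst c) \<zeta> = snd c \<and> (\<forall>t\<in>T. \<eta> < pos \<zeta> t \<and> pos \<zeta> t < b))" for c b
    define f where "f c = (SOME b. good c b)" for c
    have f: "good c (f c)" if unc: "uncountable {\<zeta> \<in> X. kind (fst c) \<zeta> = snd c}" for c
    proof -
      obtain \<zeta> where \<zeta>: "\<zeta> \<in> X" "kind (fst c) \<zeta> = snd c" "\<eta> < \<zeta>"
        using X'_large[OF unc, of \<eta>] by blast
      have "countable (pos \<zeta> ` T)"
        using \<open>finite T\<close> by (simp add: countable_finite)
      then obtain b where "\<And>x. x \<in> pos \<zeta> ` T \<Longrightarrow> x < b"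
        using countable_bound_ord1 by blast
      moreover have "\<eta> < pos \<zeta> t" if "t \<in> T" for t
        using above[OF pos(1)[OF \<zeta>(1) that]] \<zeta>(3) by simp
      ultimately have "good c b"
        using \<zeta> unfolding good_def by blast
      then show ?thesis
        unfolding f_def by (rule someI)
    qed
    have "countable (f ` (UNIV \<times> {\<tau>. finite \<tau>}))"
      using countable_finite_sets by (intro countable_image countable_SIGMA) auto
    then obtain b where "\<And>x. x \<in> f ` (UNIV \<times> {\<tau>. finite \<tau>}) \<Longrightarrow> x < b"
      using countable_bound_ord1 by blast
    then have b: "f (K, \<tau>) < b" if "finite \<tau>" for K \<tau>
      using that by blast
    show ?thesis
      unfolding reach_def
    proof (intro exI[of _ b] allI impI)
      fix K and \<tau> :: "(bool list \<times> bool list) set"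
      assume "finite \<tau>" "uncountable {\<zeta> \<in> X. kind K \<zeta> = \<tau>}"
      with f[of "(K, \<tau>)"] b[of \<tau> K] show
        "\<exists>\<zeta>\<in>X. kind K \<zeta> = \<tau> \<and> (\<forall>t\<in>T. \<eta> < pos \<zeta> t \<and> pos \<zeta> t < b)"
        unfolding good_def fst_conv snd_conv by (meson less_trans)
    qed
  qed
  then obtain g where "\<And>\<eta>. reach \<eta> (g \<eta>)"
    by metis
  then have g: "\<exists>\<zeta>\<in>X. kind K \<zeta> = \<tau> \<and> (\<forall>t\<in>T. \<eta> < pos \<zeta> t \<and> pos \<zeta> t < g \<eta>)"
    if "finite \<tau>" "uncountable {\<zeta> \<in> X. kind K \<zeta> = \<tau>}" for \<eta> K \<tau>
    using that unfolding reach_def by blast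

  have "\<exists>\<delta>. q \<delta> = Some t0 \<and> closure_point g \<delta> \<and> \<eta> < \<delta>" for \<eta>
    using stationary_unbounded[OF stationary_q[of "Some t0"], of g \<eta>] by blast
  then obtain g' where g': "\<And>\<eta>. q (g' \<eta>) = Some t0 \<and> closure_point g (g' \<eta>) \<and> \<eta> < g' \<eta>"
    by metis
  obtain h where h: "\<And>n \<delta>. closure_point h \<delta> \<Longrightarrow> closure_point (if n then g else g') \<delta>"
    using closure_point_common[of "\<lambda>n. if n then g else g'"] by blast
  \<comment> \<open>Closure under \<open>g'\<close> later supplies, above any bound below \<delta>',
    an ordinal \<delta> < \<delta>' with \<open>q \<delta> = Some t0\<close>.\<close>
  obtain \<delta>' where "q \<delta>' = None" and "closure_point h \<delta>'"
    using stationary_q unfolding stationary_def by blast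
  then have \<delta>': "closure_point g \<delta>'" "closure_point g' \<delta>'"
    using h[of \<delta>' True] h[of \<delta>' False] by auto
  obtain \<xi> where "\<xi> \<in> X'" "\<delta>' < \<xi>"
    using X'_large[of X \<delta>'] X X_def by blast
  then have "\<xi> \<in> X"
    by (simp add: X'_def)
  define b where "b = pos \<xi>"
  have b: "\<delta>' < b t" if "t \<in> T" for t
    using above[OF pos(1)[OF \<open>\<xi> \<in> X\<close> that]] \<open>\<delta>' < \<xi>\<close> by (simp add: b_def)

  \<comment> \<open>An element \<open>\<xi>1\<close> of the same kind as \<xi> to precision
    \<open>N\<close>, with its points beyond those of \<xi>, splits from \<xi> at positions
    \<open>n t\<close> \<ge> \<open>N\<close>. Copying the kind of \<open>\<xi>1\<close> to a larger
    precision \<open>K\<close> reproduces these positions below any closure point of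
    \<open>g\<close>.\<close>
  have approx: "\<exists>n. (\<forall>t\<in>T. N \<le> n t) \<and> (\<forall>\<delta> \<eta>. closure_point g \<delta> \<longrightarrow> \<eta> < \<delta> \<longrightarrow>
      (\<exists>\<zeta>\<in>X. \<forall>t\<in>T. \<eta> < pos \<zeta> t \<and> pos \<zeta> t < \<delta> \<and> split (r (pos \<zeta> t)) (r (b t)) = n t))" for N
  proof -
    have "uncountable {\<zeta> \<in> X. kind N \<zeta> = kind N \<xi>}"
      using \<open>\<xi> \<in> X'\<close> by (simp add: X'_def)
    then obtain \<xi>1 where \<xi>1: "\<xi>1 \<in> X'" "\<xi>1 \<in> X" "kind N \<xi>1 = kind N \<xi>" "Max (b ` T) < \<xi>1"
      using X'_large[of "{\<zeta> \<in> X. kind N \<zeta> = kind N \<xi>}" "Max (b ` T)"] by blast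
    have neq: "r (pos \<xi>1 t) \<noteq> r (b t)" if "t \<in> T" for t
    proof -
      have "b t \<le> Max (b ` T)"
        using that \<open>finite T\<close> by simp
      then have "b t < pos \<xi>1 t"
        using above[OF pos(1)[OF \<xi>1(2) that]] \<xi>1(4) by simp
      then show ?thesis
        using inj_r by (simp add: inj_eq)
    qed
    define n where "n t = split (r (pos \<xi>1 t)) (r (b t))" for t
    define K where "K = Suc (Max (n ` T))"
    have n: "N \<le> n t" "n t < K" if "t \<in> T" for t
      using kindD[OF \<xi>1(3) that] neq[OF that] that \<open>finite T\<close>
      by (simp_all add: n_def b_def prefix_eq_iff_split K_def less_Suc_eq_le)
    have "\<exists>\<zeta>\<in>X. \<forall>t\<in>T. \<eta> < pos \<zeta> t \<and> pos \<zeta> t < \<delta> \<and> split (r (pos \<zeta> t)) (r (b t)) = n t"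
      if \<delta>: "closure_point g \<delta>" "\<eta> < \<delta>" for \<delta> \<eta>
    proof -
      have "finite (kind K \<xi>1)"
        using \<open>finite T\<close> by (simp add: kind_def)
      moreover have "uncountable {\<zeta> \<in> X. kind K \<zeta> = kind K \<xi>1}"
        using \<xi>1(1) by (simp add: X'_def)
      ultimately obtain \<zeta> where \<zeta>: "\<zeta> \<in> X" "kind K \<zeta> = kind K \<xi>1"
        "\<And>t. t \<in> T \<Longrightarrow> \<eta> < pos \<zeta> t \<and> pos \<zeta> t < g \<eta>"
        using g by meson
      have "g \<eta> < \<delta>"
        using \<delta> by (simp add: closure_point_def)
      moreover have "split (r (pos \<zeta> t)) (r (b t)) = n t" if "t \<in> T" for t
      proof -
        have *: "prefix K (r (pos \<zeta> t)) = prefix K (r (pos \<xi>1 t))"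
          using kindD[OF \<zeta>(2) that] .
        moreover have "prefix K (r (pos \<xi>1 t)) \<noteq> prefix K (r (b t))"
          using n(2)[OF that] prefix_eq_iff_split[OF neq[OF that]] by (simp add: n_def)
        ultimately show ?thesis
          unfolding n_def by (intro split_cong[of K]) auto
      qed
      ultimately show ?thesis
        using \<zeta> by (meson less_trans)
    qed
    then show ?thesis
      using n by blast
  qed

  show ?thesis
  proof (intro exI[of _ \<xi>] notI)
    let ?E = "{\<zeta>. (\<forall>\<gamma>\<in>keys (u \<zeta>). \<forall>\<gamma>'\<in>keys (u \<xi>). \<gamma> < \<gamma>') \<and> \<not> int p dvd bil colour (u \<zeta>) (u \<xi>)}"
    assume "finite ?E"
    \<comment> \<open>\<open>N \<delta>\<close> bounds the numbers of \<delta> in the enumerations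
      for all \<open>b t\<close>, so every resolution of at least \<open>N \<delta>\<close> makes a
      \<delta> below \<open>b t\<close> a mark.\<close>
    have "\<exists>N. \<forall>t\<in>T. e (b t) \<delta> \<le> N" for \<delta>
      using \<open>finite T\<close> by (intro exI[of _ "Max ((\<lambda>t. e (b t) \<delta>) ` T)"]) auto
    then obtain N where N: "\<And>\<delta> t. t \<in> T \<Longrightarrow> e (b t) \<delta> \<le> N \<delta>"
      by metis
    obtain n' where n': "\<And>t. t \<in> T \<Longrightarrow> N \<delta>' \<le> n' t"
      and n'_approx: "\<And>\<delta> \<eta>. closure_point g \<delta> \<Longrightarrow> \<eta> < \<delta> \<Longrightarrow>
        \<exists>\<zeta>\<in>X. \<forall>t\<in>T. \<eta> < pos \<zeta> t \<and> pos \<zeta> t < \<delta> \<and> split (r (pos \<zeta> t)) (r (b t)) = n' t"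
      using approx[of "N \<delta>'"] by blast
    have "finite (\<Union>t\<in>T. marks (n' t) (b t))" and "\<exists>\<eta>. \<eta> < \<delta>'"
      using \<open>finite T\<close> \<delta>'(1) by (simp_all add: closure_point_def)
    then obtain \<eta>0 where \<eta>0: "\<eta>0 < \<delta>'"
      "\<And>\<eta>. \<eta> \<in> (\<Union>t\<in>T. marks (n' t) (b t)) \<Longrightarrow> \<eta> < \<delta>' \<Longrightarrow> \<eta> \<le> \<eta>0"
      using finite_bound_below by metis
    \<comment> \<open>Above \<open>\<eta>0\<close> there is no mark of resolution
      \<open>n' t\<close> below \<delta>', so at that resolution \<delta> and \<delta>' have the
      same bracket.\<close>
    define \<delta> where "\<delta> = g' \<eta>0"
    have \<delta>: "q \<delta> = Some t0" "closure_point g \<delta>" "\<eta>0 < \<delta>" "\<delta> < \<delta>'"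
      using g'[of \<eta>0] \<delta>'(2) \<eta>0(1) by (auto simp: \<delta>_def closure_point_def)
    obtain n where n: "\<And>t. t \<in> T \<Longrightarrow> N \<delta> \<le> n t"
      and n_approx: "\<And>\<delta> \<eta>. closure_point g \<delta> \<Longrightarrow> \<eta> < \<delta> \<Longrightarrow>
        \<exists>\<zeta>\<in>X. \<forall>t\<in>T. \<eta> < pos \<zeta> t \<and> pos \<zeta> t < \<delta> \<and> split (r (pos \<zeta> t)) (r (b t)) = n t"
      using approx[of "N \<delta>"] by blast
    \<comment> \<open>\<open>W\<close> collects the marks for all resolutions in use and the
      supports of the supposedly finitely many exceptional \<zeta>. Points between
      \<open>\<eta>1\<close> and \<delta> avoid it: their brackets are those of \<delta>, and a
      \<zeta> supported there is not exceptional.\<close>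
    define W where "W = (\<Union>t\<in>T. marks (n t) (b t) \<union> marks (n' t) (b t) \<union>
      (\<Union>s\<in>T. marks (split (r (b s)) (r (b t))) (b t))) \<union> (\<Union>\<zeta>\<in>?E. keys (u \<zeta>))"
    have "finite W"
      unfolding W_def using \<open>finite T\<close> \<open>finite ?E\<close> by (intro finite_UnI finite_UN_I) auto
    then obtain \<eta>1 where \<eta>1: "\<eta>1 < \<delta>" "\<And>\<eta>. \<eta> \<in> W \<Longrightarrow> \<eta> < \<delta> \<Longrightarrow> \<eta> \<le> \<eta>1"
      using finite_bound_below[of W \<eta>0 \<delta>] \<delta>(3) by metis

    have null: "int p dvd bil colour (u \<zeta>) (u \<xi>)"
      if "\<zeta> \<in> X" "\<And>t. t \<in> T \<Longrightarrow> \<eta>1 < pos \<zeta> t \<and> pos \<zeta> t < \<delta>" for \<zeta>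
    proof (rule ccontr)
      assume "\<not> int p dvd bil colour (u \<zeta>) (u \<xi>)"
      moreover have "\<gamma> < \<gamma>'" if "\<gamma> \<in> keys (u \<zeta>)" "\<gamma>' \<in> keys (u \<xi>)" for \<gamma> \<gamma>'
      proof -
        from that obtain s t where "s \<in> T" "\<gamma> = pos \<zeta> s" "t \<in> T" "\<gamma>' = b t"
          unfolding keys[OF \<open>\<zeta> \<in> X\<close>] keys[OF \<open>\<xi> \<in> X\<close>] b_def by blast
        then show ?thesis
          using \<open>\<And>t. t \<in> T \<Longrightarrow> \<eta>1 < pos \<zeta> t \<and> pos \<zeta> t < \<delta>\<close>[of s] b[of t] \<delta>(4)
          by (auto intro: less_trans)
      qed
      ultimately have "\<zeta> \<in> ?E"
        by blast
      then have "pos \<zeta> t0 \<in> W"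
        using pos(1)[OF that(1) \<open>t0 \<in> T\<close>] unfolding W_def by blast
      then show False
        using \<eta>1(2)[of "pos \<zeta> t0"] that(2)[OF \<open>t0 \<in> T\<close>] by (auto dest: leD)
    qed
    have shift: "bracket k (pos \<zeta> s) (b t) = bracket k \<delta> (b t)"
      if "marks k (b t) \<subseteq> W" "\<eta>1 < pos \<zeta> s" "pos \<zeta> s < \<delta>" for k \<zeta> s t
      using that \<eta>1(2) by (intro bracket_shift) (auto intro: le_less_trans)
    obtain \<zeta> where \<zeta>: "\<zeta> \<in> X" "\<And>t. t \<in> T \<Longrightarrow> \<eta>1 < pos \<zeta> t \<and> pos \<zeta> t < \<delta>"
        "\<And>t. t \<in> T \<Longrightarrow> split (r (pos \<zeta> t)) (r (b t)) = n t"
      using n_approx[OF \<delta>(2) \<eta>1(1)] by blast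
    obtain \<zeta>' where \<zeta>': "\<zeta>' \<in> X" "\<And>t. t \<in> T \<Longrightarrow> \<eta>1 < pos \<zeta>' t \<and> pos \<zeta>' t < \<delta>"
        "\<And>t. t \<in> T \<Longrightarrow> split (r (pos \<zeta>' t)) (r (b t)) = n' t"
      using n'_approx[OF \<delta>(2) \<eta>1(1)] by blast
    have prefix_b: "prefix m (r (b t)) = t" if "t \<in> T" for t
      using pos(2)[OF \<open>\<xi> \<in> X\<close> that] by (simp add: b_def)
    have len_t0: "length t0 = m"
      using prefix_b[OF \<open>t0 \<in> T\<close>] by (metis length_prefix)
    have less_b: "pos \<zeta> s < b t" "pos \<zeta>' s < b t" if "s \<in> T" "t \<in> T" for s t
      using \<zeta>(2)[OF that(1)] \<zeta>'(2)[OF that(1)] b[OF that(2)] \<delta>(4) by (auto intro: less_trans)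
    \<comment> \<open>Different prefixes \<open>s\<close> and \<open>t\<close> force the split
      before position \<open>m\<close>, at a place depending on \<open>s\<close> and
      \<open>t\<close> only; neither bracket nor code can then tell \<zeta> from \<zeta>'.\<close>
    have off: "colour (pos \<zeta> s) (b t) = colour (pos \<zeta>' s) (b t)" if "s \<in> T" "t \<in> T" "s \<noteq> t" for s t
    proof -
      let ?k = "split (r (b s)) (r (b t))"
      have "split (r (pos \<zeta> s)) (r (b t)) = ?k" "split (r (pos \<zeta>' s)) (r (b t)) = ?k"
        using that pos(2)[OF \<zeta>(1)] pos(2)[OF \<zeta>'(1)] prefix_b by (auto intro!: split_cong[of m])
      moreover have "marks ?k (b t) \<subseteq> W"
        unfolding W_def using that by blast
      then have "bracket ?k (pos \<zeta> s) (b t) = bracket ?k (pos \<zeta>' s) (b t)"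
        using shift \<zeta>(2) \<zeta>'(2) that by metis
      moreover have "code x (pos \<zeta> s) (b t) = code x (pos \<zeta>' s) (b t)" for x
        using that pos(2)[OF \<zeta>(1)] pos(2)[OF \<zeta>'(1)] prefix_b by (intro code_off_diagonal[of m]) auto
      ultimately show ?thesis
        using less_b that by (simp add: colour_def)
    qed
    \<comment> \<open>The bracket equals \<delta>, whose string \<open>t0\<close> has length
      \<open>m\<close>; the code thus compares the prefix \<open>t\<close> with
      \<open>t0\<close>.\<close>
    have diag: "colour (pos \<zeta> t) (b t) = of_bool (t = t0)" if "t \<in> T" for t
    proof -
      have "marks (n t) (b t) \<subseteq> W"
        unfolding W_def using that by blast
      then have "bracket (n t) (pos \<zeta> t) (b t) = bracket (n t) \<delta> (b t)"
        using shift \<zeta>(2)[OF that] by blast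
      also have "\<dots> = \<delta>"
        using N[OF that, of \<delta>] n[OF that] b[OF that] \<delta>(4)
        by (intro bracket_mark) (auto simp: marks_def)
      finally show ?thesis
        using \<zeta>(3)[OF that] less_b[OF that that] \<delta>(1) len_t0 prefix_b[OF that] pos(2)[OF \<zeta>(1) that]
        by (auto simp: colour_def code_def)
    qed
    have diag': "colour (pos \<zeta>' t) (b t) = 0" if "t \<in> T" for t
    proof -
      have "marks (n' t) (b t) \<subseteq> W"
        unfolding W_def using that by blast
      then have "bracket (n' t) (pos \<zeta>' t) (b t) = bracket (n' t) \<delta> (b t)"
        using shift \<zeta>'(2)[OF that] by blast
      also have "\<dots> = bracket (n' t) \<delta>' (b t)"
      proof (rule bracket_shift)
        show "\<delta> \<le> \<delta>'"
          using \<delta>(4) by simp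
        show "\<eta> < \<delta>" if "\<eta> \<in> marks (n' t) (b t)" "\<eta> < \<delta>'" for \<eta>
          using \<eta>0(2)[of \<eta>] that \<open>t \<in> T\<close> \<delta>(3) by (auto intro: le_less_trans)
      qed
      also have "\<dots> = \<delta>'"
        using N[OF that, of \<delta>'] n'[OF that] b[OF that]
        by (intro bracket_mark) (auto simp: marks_def)
      finally show ?thesis
        using \<zeta>'(3)[OF that] less_b[OF that that] \<open>q \<delta>' = None\<close> by (simp add: colour_def code_def)
    qed
    have "bil colour (u \<zeta>) (u \<xi>) - bil colour (u \<zeta>') (u \<xi>) =
      (\<Sum>s\<in>T. \<Sum>t\<in>T. d s * d t * (colour (pos \<zeta> s) (b t) - colour (pos \<zeta>' s) (b t)))"
      using \<zeta>(1) \<zeta>'(1) \<open>\<xi> \<in> X\<close> by (simp add: bil_u b_def sum_subtractf algebra_simps)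
    also have "\<dots> = (\<Sum>s\<in>T. \<Sum>t\<in>T. if s = t0 \<and> t = t0 then d t0 * d t0 else 0)"
    proof (intro sum.cong refl)
      fix s t
      assume "s \<in> T" "t \<in> T"
      then show "d s * d t * (colour (pos \<zeta> s) (b t) - colour (pos \<zeta>' s) (b t)) =
        (if s = t0 \<and> t = t0 then d t0 * d t0 else 0)"
        using off[of s t] diag[of t] diag'[of t] by (cases "s = t") auto
    qed
    also have "\<dots> = (\<Sum>s\<in>T. if s = t0 then d t0 * d t0 else 0)"
      using \<open>finite T\<close> \<open>t0 \<in> T\<close> by (intro sum.cong) auto
    also have "\<dots> = d t0 * d t0"
      using \<open>finite T\<close> \<open>t0 \<in> T\<close> by simp
    finally have "int p dvd d t0 * d t0"
      using null[OF \<zeta>(1,2)] null[OF \<zeta>'(1,2)] by (metis dvd_diff)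
    then have "int p dvd d t0"
      using assms(1) by (simp add: prime_dvd_mult_iff)
    then show False
      using coprime[OF pos(1)[OF \<open>\<xi> \<in> X\<close> \<open>t0 \<in> T\<close>]] d[OF \<open>\<xi> \<in> X\<close> \<open>t0 \<in> T\<close>] by simp
  qed
qed

end


text \<open>By Cantor's theorem the continuum exceeds \<open>natLeq\<close>, and
  \<open>omega1\<close> is the least such cardinal.\<close>

lemma ex_injection_reals:
  obtains r :: "ord1 \<Rightarrow> nat \<Rightarrow> bool" where "inj r"
proof -
  have "|UNIV :: nat set| <o |UNIV :: nat set set|"
    by (metis Pow_UNIV card_of_Pow)
  then have "natLeq <o |UNIV :: nat set set|"
    using card_of_nat ordIso_ordLess_trans ordIso_symmetric by blast
  then have "omega1 \<le>o |UNIV :: nat set set|"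
    by (rule cardSuc_least[OF natLeq_Card_order card_of_Card_order])
  then have "|UNIV :: ord1 set| \<le>o |UNIV :: nat set set|"
    using card_of_ord1 ordIso_ordLeq_trans by blast
  then obtain f :: "ord1 \<Rightarrow> nat set" where "inj f"
    using card_of_ordLeq[of "UNIV :: ord1 set" "UNIV :: nat set set"] by auto
  then have "inj (\<lambda>x n. n \<in> f x)"
    by (simp add: inj_def fun_eq_iff set_eq_iff)
  then show ?thesis
    using that by blast
qed

text \<open>\<open>c \<alpha> \<beta>\<close> is only meant for \<open>\<alpha> < \<beta>\<close>; it is padded by zeros so that \<open>bil c\<close> minus its transpose is
  the alternating form with these values.\<close>

definition strong_colouring :: "nat \<Rightarrow> (ord1 \<Rightarrow> ord1 \<Rightarrow> int) \<Rightarrow> bool" where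
  "strong_colouring p c \<longleftrightarrow> (\<forall>\<alpha> \<beta>. \<beta> \<le> \<alpha> \<longrightarrow> c \<alpha> \<beta> = 0) \<and>
     (\<forall>u. (\<forall>\<xi>. keys (u \<xi>) \<noteq> {} \<and> (\<forall>\<gamma>\<in>keys (u \<xi>). \<xi> \<le> \<gamma> \<and> \<not> int p dvd lookup (u \<xi>) \<gamma>)) \<longrightarrow>
       (\<exists>\<xi>. infinite {\<zeta>. (\<forall>\<gamma>\<in>keys (u \<zeta>). \<forall>\<gamma>'\<in>keys (u \<xi>). \<gamma> < \<gamma>') \<and>
                          \<not> int p dvd bil c (u \<zeta>) (u \<xi>)}))"

lemma ex_strong_colouring:
  assumes "prime p"
  obtains c where "strong_colouring p c"
proof -
  obtain r :: "ord1 \<Rightarrow> nat \<Rightarrow> bool" where "inj r"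
    using ex_injection_reals by blast
  moreover obtain e :: "ord1 \<Rightarrow> ord1 \<Rightarrow> nat" where "\<And>\<beta>. inj_on (e \<beta>) {..\<beta>}"
    using ex_enumerations by blast
  moreover obtain q :: "ord1 \<Rightarrow> bool list option" where "\<And>j. stationary {\<beta>. q \<beta> = j}"
    using stationary_partition by blast
  ultimately interpret colouring r e q
    by unfold_locales
  have "colour \<alpha> \<beta> = 0" if "\<beta> \<le> \<alpha>" for \<alpha> \<beta>
    using that by (simp add: colour_def)
  then have "strong_colouring p colour"
    unfolding strong_colouring_def using colour_not_almost_null[OF assms] by blast
  then show ?thesis
    using that by blast
qed

section \<open>The alternating form of a Kurepa family\<close>

definition red :: "nat \<Rightarrow> ('i \<Rightarrow>\<^sub>0 int) \<Rightarrow> ('i \<Rightarrow>\<^sub>0 int)" where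
  "red p v = Poly_Mapping.map (\<lambda>a. a mod int p) v"

lemma lookup_red [simp]: "lookup (red p v) i = lookup v i mod int p"
  by (simp add: red_def Poly_Mapping.map.rep_eq when_def)

lemma dvd_lin:
  assumes "\<And>i. d dvd lookup v i"
  shows "d dvd lin f v"
  unfolding lin_def using assms by (intro dvd_sum dvd_mult2)

lemma dvd_lin_fun:
  assumes "\<And>i. d dvd f i"
  shows "d dvd lin f v"
  unfolding lin_def using assms by (intro dvd_sum dvd_mult)

lemma dvd_bil_left: "(\<And>i. d dvd lookup v i) \<Longrightarrow> d dvd bil b v w"
  unfolding bil_def by (rule dvd_lin)

lemma dvd_bil_right: "(\<And>i. d dvd lookup w i) \<Longrightarrow> d dvd bil b v w"
  unfolding bil_def by (intro dvd_lin_fun dvd_lin)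

text \<open>The graph of \<open>v\<close> on \<open>D\<close> without zero values is a finite set,
  which reduces countability to counting finite subsets.\<close>

definition restr :: "'i set \<Rightarrow> ('i \<Rightarrow>\<^sub>0 int) \<Rightarrow> ('i \<times> int) set" where
  "restr D v = (\<lambda>i. (i, lookup v i)) ` (keys v \<inter> D)"

lemma restr_eqD:
  assumes "restr D v = restr D w" "i \<in> D"
  shows "lookup v i = lookup w i"
proof (cases "i \<in> keys v \<union> keys w")
  case True
  then have "(i, lookup v i) \<in> restr D v \<or> (i, lookup w i) \<in> restr D w"
    using assms(2) by (auto simp: restr_def)
  then have "(i, lookup v i) \<in> restr D w \<or> (i, lookup w i) \<in> restr D v"
    using assms(1) by simp
  then show ?thesis
    by (auto simp: restr_def)
next
  case False
  then show ?thesis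
    by (simp add: in_keys_iff)
qed

lemma countable_restr:
  assumes "countable D"
  shows "countable (range (restr D))"
proof (rule countable_subset)
  show "range (restr D) \<subseteq> {X. X \<subseteq> D \<times> UNIV \<and> finite X}"
    by (auto simp: restr_def)
  show "countable {X. X \<subseteq> D \<times> (UNIV :: int set) \<and> finite X}"
    using countable_Collect_finite_subset[of "D \<times> (UNIV :: int set)"] assms by (simp add: conj_commute)
qed

lemma card_of_poly_mapping:
  assumes "infinite (UNIV :: 'i set)"
  shows "|UNIV :: ('i \<Rightarrow>\<^sub>0 int) set| \<le>o |UNIV :: 'i set|"
proof -
  have "inj (\<lambda>v :: 'i \<Rightarrow>\<^sub>0 int. restr UNIV v)"
    by (rule injI, rule poly_mapping_eqI) (auto dest: restr_eqD)
  moreover have "range (\<lambda>v :: 'i \<Rightarrow>\<^sub>0 int. restr UNIV v) \<subseteq> Fpow UNIV"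
    by (auto simp: restr_def Fpow_def)
  ultimately have "|UNIV :: ('i \<Rightarrow>\<^sub>0 int) set| \<le>o |Fpow (UNIV :: ('i \<times> int) set)|"
    using card_of_ordLeq by blast
  also have "|Fpow (UNIV :: ('i \<times> int) set)| =o |UNIV :: ('i \<times> int) set|"
    using assms by (intro card_of_Fpow_infinite) (simp add: finite_prod)
  also have "|UNIV :: ('i \<times> int) set| \<le>o |UNIV :: 'i set|"
  proof -
    have "|UNIV :: int set| \<le>o |UNIV :: nat set|"
      using card_of_ordLeq[of "UNIV :: int set" "UNIV :: nat set"] inj_to_nat by blast
    also have "|UNIV :: nat set| \<le>o |UNIV :: 'i set|"
      using assms infinite_iff_card_of_nat by blast
    finally show ?thesis
      using card_of_Times_infinite[OF assms, of "UNIV :: int set"] by (simp add: ordIso_imp_ordLeq)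
  qed
  finally show ?thesis .
qed

text \<open>Countability of the traces reflects countable levels of the tree; eventual disjointness,
  uniform over countable sets of indices, reflects that distinct branches separate.\<close>

locale kurepa_form =
  fixes p :: nat and c :: "ord1 \<Rightarrow> ord1 \<Rightarrow> int" and A :: "'l \<Rightarrow> ord1 set"
  assumes prime_p: "prime p"
    and strong: "strong_colouring p c"
    and countable_traces: "countable (range (\<lambda>k. A k \<inter> {..<\<delta>}))"
    and eventually_disjoint: "countable F \<Longrightarrow> \<exists>\<gamma>. \<forall>k\<in>F. \<forall>l\<in>F. k \<noteq> l \<longrightarrow> A k \<inter> A l \<subseteq> {..<\<gamma>}"
begin

type_synonym 'k vec = "(ord1 \<Rightarrow>\<^sub>0 int) \<times> ('k \<Rightarrow>\<^sub>0 int)"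

definition ind :: "ord1 \<Rightarrow> 'l \<Rightarrow> int" where
  "ind \<gamma> k = of_bool (\<gamma> \<in> A k)"

text \<open>A bilinear cocycle whose alternation \<open>alt\<close> is the intended form. No summand
  pairs two second components, so the second factor is totally isotropic.\<close>

definition form :: "'l vec \<Rightarrow> 'l vec \<Rightarrow> int" where
  "form v w = bil c (fst v) (fst w) + bil ind (fst w) (snd v)"

definition alt :: "'l vec \<Rightarrow> 'l vec \<Rightarrow> int" where
  "alt v w = form v w - form w v"

definition null :: "'l vec set" where
  "null = {v. (\<forall>i. int p dvd lookup (fst v) i) \<and> (\<forall>k. int p dvd lookup (snd v) k)}"

definition trace :: "ord1 \<Rightarrow> ('l \<Rightarrow>\<^sub>0 int) \<Rightarrow> ord1 \<Rightarrow> int" where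
  "trace \<delta> y = (\<lambda>\<gamma>. if \<gamma> < \<delta> then lin (ind \<gamma>) y else 0)"

text \<open>A trace is a finite integer combination of indicator functions of sets
  \<open>A k\<close> cut at \<delta>, and there are only countably many of these.\<close>

lemma countable_trace: "countable (range (trace \<delta>))"
proof -
  let ?T = "range (\<lambda>k. A k \<inter> {..<\<delta>})"
  let ?h = "\<lambda>xs \<gamma>. \<Sum>(X, a)\<leftarrow>xs. a * of_bool (\<gamma> \<in> X) :: int"
  have "trace \<delta> y \<in> ?h ` lists (?T \<times> UNIV)" for y
  proof -
    obtain ks where ks: "set ks = keys y" "distinct ks"
      using finite_distinct_list[of "keys y"] by auto
    let ?xs = "map (\<lambda>k. (A k \<inter> {..<\<delta>}, lookup y k)) ks"
    have "trace \<delta> y = ?h ?xs"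
      by (auto simp: trace_def lin_def ind_def o_def ks sum_list_distinct_conv_sum_set fun_eq_iff)
    moreover have "?xs \<in> lists (?T \<times> UNIV)"
      by auto
    ultimately show ?thesis
      by blast
  qed
  then have "range (trace \<delta>) \<subseteq> ?h ` lists (?T \<times> UNIV)"
    by blast
  moreover have "countable (?h ` lists (?T \<times> UNIV))"
    by (intro countable_image countable_lists countable_SIGMA countable_traces countableI_type)
  ultimately show ?thesis
    using countable_subset by blast
qed

lemma bil_ind_trace:
  assumes "keys u \<subseteq> {..<\<delta>}"
  shows "bil ind u y = lin (trace \<delta> y) u"
  unfolding bil_def using assms by (intro lin_cong) (auto simp: trace_def)

lemma form_add_left: "form (v + v') w = form v w + form v' w"
  by (simp add: form_def bil_add_left bil_add_right)

lemma form_add_right: "form v (w + w') = form v w + form v w'"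
  by (simp add: form_def bil_add_left bil_add_right)

lemma form_diff_left: "form (v - v') w = form v w - form v' w"
  by (simp add: form_def bil_diff_left bil_diff_right)

lemma form_diff_right: "form v (w - w') = form v w - form v w'"
  by (simp add: form_def bil_diff_left bil_diff_right)

lemma alt_diff_left: "alt (v - v') w = alt v w - alt v' w"
  by (simp add: alt_def form_diff_left form_diff_right)

lemma alt_diff_right: "alt v (w - w') = alt v w - alt v w'"
  by (simp add: alt_def form_diff_left form_diff_right)

lemma dvd_form_left: "v \<in> null \<Longrightarrow> int p dvd form v w"
  unfolding form_def null_def by (intro dvd_add dvd_bil_left[of _ "fst v"] dvd_bil_right[of _ "snd v"]) auto

lemma dvd_form_right: "w \<in> null \<Longrightarrow> int p dvd form v w"
  unfolding form_def null_def by (intro dvd_add dvd_bil_left[of _ "fst w"] dvd_bil_right[of _ "fst w"]) auto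

lemma isotropic_projection_countable:
  assumes diff: "\<And>v w. v \<in> S \<Longrightarrow> w \<in> S \<Longrightarrow> v - w \<in> S"
    and null: "null \<subseteq> S"
    and isotropic: "\<And>v w. v \<in> S \<Longrightarrow> w \<in> S \<Longrightarrow> int p dvd alt v w"
  shows "countable ((\<lambda>v. red p (fst v)) ` S)"
proof (rule ccontr)
  assume "uncountable ((\<lambda>v. red p (fst v)) ` S)"
  \<comment> \<open>\<open>S0\<close> holds one element of \<open>S\<close> for each projection, so
    its distinct elements differ modulo \<open>p\<close> in the first component.\<close>
  moreover obtain S0 where S0: "S0 \<subseteq> S" "inj_on (\<lambda>v. red p (fst v)) S0"
    "(\<lambda>v. red p (fst v)) ` S = (\<lambda>v. red p (fst v)) ` S0"
    using subset_image_inj[of "(\<lambda>v. red p (fst v)) ` S" "\<lambda>v. red p (fst v)" S] by blast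
  ultimately have "uncountable S0"
    using countable_image by metis
  \<comment> \<open>\<open>X\<close> holds the earlier terms. The last clause allows each node of
    the new support to lie in at most one of the sets \<open>A k\<close> that those terms
    use.\<close>
  define step where "step X \<xi> t \<longleftrightarrow> t \<in> S \<and> keys (fst t) \<noteq> {} \<and>
      (\<forall>\<gamma>\<in>keys (fst t). \<xi> \<le> \<gamma> \<and> \<not> int p dvd lookup (fst t) \<gamma>) \<and>
      (\<forall>x\<in>X. (\<forall>\<gamma>\<in>keys (fst x). \<forall>\<gamma>'\<in>keys (fst t). \<gamma> < \<gamma>') \<and>
        keys (snd x) \<inter> keys (snd t) = {} \<and> bil ind (fst x) (snd t) = 0) \<and>
      (\<forall>\<gamma>\<in>keys (fst t). \<forall>x\<in>X. \<forall>x'\<in>X. \<forall>k\<in>keys (snd x). \<forall>l\<in>keys (snd x'). \<gamma> \<in> A k \<longrightarrow> \<gamma> \<in> A l \<longrightarrow> k = l)"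
    for X :: "'l vec set" and \<xi> t
  have ex_step: "\<exists>t. step X \<xi> t" if "countable X" for X \<xi>
  proof -
    define D where "D = (\<Union>x\<in>X. keys (snd x))"
    have "countable D"
      unfolding D_def using that by (intro countable_UN) (auto intro: countable_finite)
    then obtain \<gamma>0 where \<gamma>0: "\<And>k l. k \<in> D \<Longrightarrow> l \<in> D \<Longrightarrow> k \<noteq> l \<Longrightarrow> A k \<inter> A l \<subseteq> {..<\<gamma>0}"
      using eventually_disjoint by meson
    have "countable ({\<xi>, \<gamma>0} \<union> (\<Union>x\<in>X. keys (fst x)))"
      using that by (intro countable_Un countable_UN) (auto intro: countable_finite)
    then obtain \<delta> where \<delta>: "\<And>\<gamma>. \<gamma> \<in> {\<xi>, \<gamma>0} \<union> (\<Union>x\<in>X. keys (fst x)) \<Longrightarrow> \<gamma> < \<delta>"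
      using countable_bound_ord1 by blast
    \<comment> \<open>The countably many values of \<open>f\<close> force a collision in
      \<open>S0\<close>. The difference of colliding elements, with first components reduced, has
      support from \<delta> on, uses no index of \<open>D\<close> and acts as zero below
      \<delta>.\<close>
    define f where "f v = (restr {..<\<delta>} (red p (fst v)), restr D (snd v), trace \<delta> (snd v))" for v
    have "countable (f ` S0)"
      by (rule countable_subset[of _ "range (restr {..<\<delta>}) \<times> range (restr D) \<times> range (trace \<delta>)"])
        (auto simp: f_def intro!: countable_SIGMA countable_restr countable_trace \<open>countable D\<close>)
    then have "\<not> inj_on f S0"
      using \<open>uncountable S0\<close> countable_image_inj_on by blast
    then obtain v w where vw: "v \<in> S0" "w \<in> S0" "f v = f w" "v \<noteq> w"
      by (auto simp: inj_on_def)
    then have neq: "red p (fst v) \<noteq> red p (fst w)"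
      using S0(2) by (auto dest: inj_onD)
    \<comment> \<open>Subtracting reduced coefficients makes every nonzero coefficient indivisible
      by \<open>p\<close> and changes \<open>v - w\<close> only by an element of
      \<open>null\<close>.\<close>
    define t where "t = (red p (fst v) - red p (fst w), snd v - snd w)"
    have "t \<in> S"
    proof -
      have "v - w \<in> S"
        using vw S0(1) diff by blast
      moreover have "(v - w) - t \<in> null"
        by (auto simp: null_def t_def lookup_minus mod_eq_dvd_iff[symmetric] mod_diff_eq)
      ultimately have "(v - w) - ((v - w) - t) \<in> S"
        using diff null by blast
      then show ?thesis
        by simp
    qed
    moreover have ndvd: "\<not> int p dvd lookup (fst t) \<gamma>" if "\<gamma> \<in> keys (fst t)" for \<gamma>
    proof
      assume "int p dvd lookup (fst t) \<gamma>"
      then have "(lookup (fst v) \<gamma> mod int p) mod int p = (lookup (fst w) \<gamma> mod int p) mod int p"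
        by (simp add: t_def lookup_minus flip: mod_eq_dvd_iff)
      then show False
        using that by (simp add: t_def in_keys_iff lookup_minus)
    qed
    moreover have "keys (fst t) \<noteq> {}"
      using neq by (simp add: t_def)
    moreover have ge: "\<delta> \<le> \<gamma>" if "\<gamma> \<in> keys (fst t)" for \<gamma>
    proof (rule ccontr)
      assume "\<not> \<delta> \<le> \<gamma>"
      then have "lookup (red p (fst v)) \<gamma> = lookup (red p (fst w)) \<gamma>"
        using vw(3) by (intro restr_eqD[of "{..<\<delta>}"]) (auto simp: f_def)
      then show False
        using that by (simp add: t_def in_keys_iff lookup_minus)
    qed
    moreover have "\<xi> \<le> \<gamma>" if "\<gamma> \<in> keys (fst t)" for \<gamma>
      using ge[OF that] \<delta>[of \<xi>] by auto
    moreover have "\<gamma> < \<gamma>'" if "x \<in> X" "\<gamma> \<in> keys (fst x)" "\<gamma>' \<in> keys (fst t)" for x \<gamma> \<gamma>'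
      using ge[OF that(3)] \<delta>[of \<gamma>] that by (auto intro: less_le_trans)
    moreover have "keys (snd x) \<inter> keys (snd t) = {}" if "x \<in> X" for x
    proof -
      have "lookup (snd v) k = lookup (snd w) k" if "k \<in> keys (snd x)" for k
        using vw(3) \<open>x \<in> X\<close> that by (intro restr_eqD[of D]) (auto simp: f_def D_def)
      then show ?thesis
        by (auto simp: t_def in_keys_iff lookup_minus)
    qed
    moreover have "bil ind (fst x) (snd t) = 0" if "x \<in> X" for x
    proof -
      have "keys (fst x) \<subseteq> {..<\<delta>}"
        using \<delta> that by blast
      then show ?thesis
        using vw(3) by (simp add: t_def bil_diff_right bil_ind_trace f_def)
    qed
    moreover have "k = l" if "\<gamma> \<in> keys (fst t)" "k \<in> D" "l \<in> D" "\<gamma> \<in> A k" "\<gamma> \<in> A l" for \<gamma> k l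
      using \<gamma>0[of k l] ge[of \<gamma>] \<delta>[of \<gamma>0] that by (fastforce dest: leD)
    ultimately have "step X \<xi> t"
      unfolding step_def D_def by blast
    then show ?thesis
      by blast
  qed
  have "\<exists>t. \<forall>\<xi>. step (t ` {..<\<xi>}) \<xi> (t \<xi>)"
  proof (rule dependent_wf_choice[of "{(x, y). x < y}"])
    show "wf {(x :: ord1, y). x < y}"
      by (rule wf)
  next
    fix f g :: "ord1 \<Rightarrow> 'l vec" and \<xi> t
    assume "\<And>z. (z, \<xi>) \<in> {(x, y). x < y} \<Longrightarrow> f z = g z"
    then have "f ` {..<\<xi>} = g ` {..<\<xi>}"
      by (intro image_cong) auto
    then show "step (f ` {..<\<xi>}) \<xi> t = step (g ` {..<\<xi>}) \<xi> t"
      by simp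
  next
    fix \<xi> and f :: "ord1 \<Rightarrow> 'l vec"
    show "\<exists>t. step (f ` {..<\<xi>}) \<xi> t"
      by (rule ex_step) simp
  qed
  then obtain t where t: "\<And>\<xi>. step (t ` {..<\<xi>}) \<xi> (t \<xi>)"
    by blast
  define u where "u \<xi> = fst (t \<xi>)" for \<xi>
  have u: "keys (u \<xi>) \<noteq> {} \<and> (\<forall>\<gamma>\<in>keys (u \<xi>). \<xi> \<le> \<gamma> \<and> \<not> int p dvd lookup (u \<xi>) \<gamma>)" for \<xi>
    using t[of \<xi>] unfolding step_def u_def by blast
  then obtain \<xi> where "infinite {\<zeta>. (\<forall>\<gamma>\<in>keys (u \<zeta>). \<forall>\<gamma>'\<in>keys (u \<xi>). \<gamma> < \<gamma>') \<and>
      \<not> int p dvd bil c (u \<zeta>) (u \<xi>)}" (is "infinite ?E")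
    using strong unfolding strong_colouring_def by blast
  moreover have "finite ?E"
  proof -
    have less: "\<gamma> < \<gamma>'" if "\<zeta> < \<zeta>'" "\<gamma> \<in> keys (u \<zeta>)" "\<gamma>' \<in> keys (u \<zeta>')" for \<zeta> \<zeta>' \<gamma> \<gamma>'
      using t[of \<zeta>'] that unfolding step_def u_def by blast
    have "\<zeta> < \<xi>" if "\<zeta> \<in> ?E" for \<zeta>
    proof (rule ccontr)
      assume "\<not> \<zeta> < \<xi>"
      obtain \<gamma> \<gamma>' where "\<gamma> \<in> keys (u \<zeta>)" "\<gamma>' \<in> keys (u \<xi>)"
        using u by blast
      moreover from this have "\<gamma> < \<gamma>'"
        using that by blast
      ultimately show False
        using \<open>\<not> \<zeta> < \<xi>\<close> less[of \<xi> \<zeta> \<gamma>' \<gamma>] that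
        by (cases \<zeta> \<xi> rule: linorder_cases) (auto dest: less_asym)
    qed
    note lt = this
    \<comment> \<open>Without a hit, \<open>alt (t \<zeta>) (t \<xi>)\<close> is just the colouring
      value, and isotropy contradicts that \<zeta> is exceptional. A hit determines its index
      \<open>k\<close> and, as the index supports are disjoint, also \<zeta>; so there are at most
      as many exceptional \<zeta> as nodes in the support of \<open>u \<xi>\<close>.\<close>
    define hit where "hit \<zeta> \<gamma> \<longleftrightarrow> \<gamma> \<in> keys (u \<xi>) \<and> (\<exists>k\<in>keys (snd (t \<zeta>)). \<gamma> \<in> A k)" for \<zeta> \<gamma>
    have "\<exists>\<gamma>. hit \<zeta> \<gamma>" if "\<zeta> \<in> ?E" for \<zeta>
    proof (rule ccontr)
      assume "\<nexists>\<gamma>. hit \<zeta> \<gamma>"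
      then have "bil ind (u \<xi>) (snd (t \<zeta>)) = 0"
        by (intro bil_eq_0) (auto simp: ind_def hit_def)
      moreover have "bil ind (u \<zeta>) (snd (t \<xi>)) = 0"
        using t[of \<xi>] lt[OF that] unfolding step_def u_def by blast
      moreover have "bil c (u \<xi>) (u \<zeta>) = 0"
        using strong that unfolding strong_colouring_def by (intro bil_eq_0) (auto simp: less_imp_le)
      moreover have "int p dvd alt (t \<zeta>) (t \<xi>)"
        using t by (intro isotropic) (simp_all add: step_def)
      ultimately have "int p dvd bil c (u \<zeta>) (u \<xi>)"
        by (simp add: alt_def form_def u_def)
      then show False
        using that by simp
    qed
    then have "\<forall>\<zeta>\<in>?E. \<exists>\<gamma>. hit \<zeta> \<gamma>"
      by blast
    from bchoice[OF this] obtain f where f: "\<And>\<zeta>. \<zeta> \<in> ?E \<Longrightarrow> hit \<zeta> (f \<zeta>)"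
      by blast
    have disj: "keys (snd (t \<zeta>)) \<inter> keys (snd (t \<zeta>')) = {}" if "\<zeta> < \<zeta>'" for \<zeta> \<zeta>'
      using t[of \<zeta>'] that unfolding step_def by blast
    have "inj_on f ?E"
    proof (rule inj_onI)
      fix \<zeta> \<zeta>'
      assume *: "\<zeta> \<in> ?E" "\<zeta>' \<in> ?E" "f \<zeta> = f \<zeta>'"
      obtain k l where kl: "k \<in> keys (snd (t \<zeta>))" "l \<in> keys (snd (t \<zeta>'))" "f \<zeta> \<in> A k" "f \<zeta> \<in> A l"
        using f[OF *(1)] f[OF *(2)] unfolding hit_def *(3) by blast
      have "f \<zeta> \<in> keys (u \<xi>)"
        using f[OF *(1)] by (simp add: hit_def)
      then have "k = l"
        using t[of \<xi>] kl lt[OF *(1)] lt[OF *(2)] unfolding step_def u_def by blast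
      then show "\<zeta> = \<zeta>'"
        using disj[of \<zeta> \<zeta>'] disj[of \<zeta>' \<zeta>] kl by (cases \<zeta> \<zeta>' rule: linorder_cases) auto
    qed
    moreover have "f ` ?E \<subseteq> keys (u \<xi>)"
      using f unfolding hit_def by blast
    then have "finite (f ` ?E)"
      by (rule finite_subset) simp
    ultimately show ?thesis
      using finite_imageD by blast
  qed
  ultimately show False
    by contradiction
qed

text \<open>With all supports of the projection of \<open>S\<close> below \<delta>, a coset of the
  orthogonal complement depends only on the first component and on the trace below \<delta>. This
  leaves at most \<open>omega1\<close> times countably many cosets.\<close>

lemma card_of_perp_cosets:
  assumes diff: "\<And>v w. v \<in> S \<Longrightarrow> w \<in> S \<Longrightarrow> v - w \<in> S"
    and null: "null \<subseteq> S"
    and isotropic: "\<And>v w. v \<in> S \<Longrightarrow> w \<in> S \<Longrightarrow> int p dvd alt v w"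
  shows "|range (\<lambda>v. {w. \<forall>s\<in>S. int p dvd alt (w - v) s})| \<le>o omega1"
proof -
  let ?perp = "\<lambda>v. {w. \<forall>s\<in>S. int p dvd alt (w - v) s}"
  have "countable (\<Union>u\<in>(\<lambda>v. red p (fst v)) ` S. keys u)"
    using isotropic_projection_countable[OF assms] by (intro countable_UN) (auto intro: countable_finite)
  then obtain \<delta> where \<delta>: "\<And>\<gamma>. \<gamma> \<in> (\<Union>u\<in>(\<lambda>v. red p (fst v)) ` S. keys u) \<Longrightarrow> \<gamma> < \<delta>"
    using countable_bound_ord1 by blast
  define f where "f v = (fst v, trace \<delta> (snd v))" for v :: "'l vec"
  have same: "int p dvd alt (v - w) s" if "f v = f w" "s \<in> S" for v w s
  proof -
    \<comment> \<open>Replacing \<open>s\<close> by \<open>s'\<close> costs an element of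
      \<open>null\<close> and puts the support of the first component below \<delta>.\<close>
    define s' where "s' = (red p (fst s), snd s)"
    have "s - s' \<in> null"
      by (auto simp: null_def s'_def lookup_minus mod_eq_dvd_iff[symmetric])
    then have "int p dvd alt (v - w) (s - s')"
      unfolding alt_def by (intro dvd_diff dvd_form_left dvd_form_right)
    moreover have "alt (v - w) s' = 0"
    proof -
      have "keys (fst s') \<subseteq> {..<\<delta>}"
        using \<delta> \<open>s \<in> S\<close> by (auto simp: s'_def)
      then show ?thesis
        using that(1) by (simp add: alt_def form_def f_def bil_diff_right bil_ind_trace)
    qed
    ultimately show ?thesis
      by (simp add: alt_diff_right)
  qed
  have eq: "?perp v = ?perp w" if "f v = f w" for v w
  proof (intro Collect_cong ball_cong refl)
    fix x s
    assume "s \<in> S"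
    have "alt (x - w) s = alt (x - v) s + alt (v - w) s"
      by (simp add: alt_diff_left)
    then show "int p dvd alt (x - v) s \<longleftrightarrow> int p dvd alt (x - w) s"
      using same[OF that \<open>s \<in> S\<close>] by (simp only: dvd_add_left_iff)
  qed
  define g where "g z = ?perp (SOME v. f v = z)" for z
  have gf: "g (f v) = ?perp v" for v
    unfolding g_def by (rule eq) (rule someI[of "\<lambda>w. f w = f v"], rule refl)
  have "range ?perp = g ` range f"
    unfolding image_image by (rule image_cong) (simp_all only: gf)
  then have "|range ?perp| \<le>o |range f|"
    using card_of_image by metis
  also have "|range f| \<le>o |(UNIV :: (ord1 \<Rightarrow>\<^sub>0 int) set) \<times> range (trace \<delta>)|"
    by (intro card_of_mono1) (auto simp: f_def)
  also have "|(UNIV :: (ord1 \<Rightarrow>\<^sub>0 int) set) \<times> range (trace \<delta>)| \<le>o omega1"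
  proof (rule card_of_Times_ordLeq_infinite_Field[OF _ _ _ Card_order_omega1])
    show "infinite (Field omega1)"
      using card_of_ord1 infinite_ord1 card_of_ordIso_finite_Field[OF Card_order_omega1] ordIso_symmetric by blast
    show "|UNIV :: (ord1 \<Rightarrow>\<^sub>0 int) set| \<le>o omega1"
      using card_of_poly_mapping[OF infinite_ord1] card_of_ord1 ordLeq_ordIso_trans by blast
    show "|range (trace \<delta>)| \<le>o omega1"
      using countable_trace countable_iff_ordLess_omega1 ordLess_imp_ordLeq by blast
  qed
  finally show ?thesis .
qed

end

section \<open>Branches of a Kurepa tree\<close>

lemma Field_Restr_underS:
  assumes "Partial_order r"
  shows "Field (Restr r (underS r y)) = underS r y"
  using assms
  by (intro Refl_Field_Restr2) (auto simp: partial_order_on_def preorder_on_def underS_def Field_def)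

lemma Restr_underS_underS:
  assumes "Partial_order r" "x \<in> underS r y"
  shows "Restr (Restr r (underS r y)) (underS (Restr r (underS r y)) x) = Restr r (underS r x)"
proof -
  have "trans r" "antisym r"
    using assms(1) by (auto simp: partial_order_on_def preorder_on_def)
  have xy: "(x, y) \<in> r" "x \<noteq> y"
    using assms(2) by (auto simp: underS_def)
  have sub: "z \<in> underS r y" if "z \<in> underS r x" for z
    using that xy transD[OF \<open>trans r\<close>, of z x y] antisymD[OF \<open>antisym r\<close>, of x y]
    by (auto simp: underS_def)
  then have "underS (Restr r (underS r y)) x = underS r x"
    using assms(2) by (auto simp: underS_def)
  then show ?thesis
    using sub by auto
qed

text \<open>A proper initial segment of the predecessors of \<open>y\<close> is the set of
  predecessors of some \<open>x\<close> below \<open>y\<close>.\<close>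

lemma Restr_underS_less_iff:
  assumes "Partial_order r" "Well_order (Restr r (underS r y))" "Well_order \<beta>"
  shows "\<beta> <o Restr r (underS r y) \<longleftrightarrow> (\<exists>x\<in>underS r y. \<beta> =o Restr r (underS r x))"
  using ordLess_iff_ordIso_Restr[OF assms(2,3)] Restr_underS_underS[OF assms(1)]
  by (simp add: Field_Restr_underS[OF assms(1)])

definition seg :: "ord1 \<Rightarrow> nat set rel" where
  "seg \<alpha> = Restr omega1 (underS omega1 (Rep_ord1 \<alpha>))"

lemma Partial_order_omega1: "Partial_order omega1"
  using Well_order_omega1 by (simp add: well_order_on_def linear_order_on_def)

lemma Well_order_seg: "Well_order (seg \<alpha>)"
  unfolding seg_def by (rule Well_order_Restr[OF Well_order_omega1])

lemma ex_seg:
  assumes "Well_order \<beta>" "\<beta> <o omega1"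
  shows "\<exists>\<alpha>. \<beta> =o seg \<alpha>"
proof -
  obtain a where "a \<in> Field omega1" "\<beta> =o Restr omega1 (underS omega1 a)"
    using ordLess_iff_ordIso_Restr[OF Well_order_omega1 assms(1)] assms(2) by blast
  then show ?thesis
    unfolding seg_def by (metis Rep_ord1_cases)
qed

lemma seg_less:
  assumes "\<alpha> < \<beta>"
  shows "seg \<alpha> <o seg \<beta>"
proof -
  have "Rep_ord1 \<alpha> \<in> underS omega1 (Rep_ord1 \<beta>)"
    using assms by (auto simp: underS_def less_ord1_def less_eq_ord1_def Rep_ord1_inject)
  then show ?thesis
    using Restr_underS_less_iff[OF Partial_order_omega1 Well_order_seg[unfolded seg_def] Well_order_seg, of \<alpha> \<beta>]
      ordIso_reflexive[OF Well_order_seg[of \<alpha>]] unfolding seg_def by blast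
qed

lemma seg_less_iff: "seg \<alpha> <o seg \<beta> \<longleftrightarrow> \<alpha> < \<beta>"
proof
  assume "seg \<alpha> <o seg \<beta>"
  then have "\<alpha> \<noteq> \<beta>" "\<not> \<beta> < \<alpha>"
    using seg_less ordLess_irreflexive ordLess_transitive by blast+
  then show "\<alpha> < \<beta>"
    by simp
qed (rule seg_less)

lemma seg_iso_iff: "seg \<alpha> =o seg \<beta> \<longleftrightarrow> \<alpha> = \<beta>"
  by (metis Well_order_seg linorder_neqE not_ordLess_ordIso ordIso_reflexive ordIso_symmetric seg_less)

locale kurepa =
  fixes r :: "'a rel"
  assumes kurepa: "kurepa_tree r"
begin

abbreviation "ht_ord x \<equiv> Restr r (underS r x)"

lemma Partial_order_r: "Partial_order r"
  and Well_order_ht: "x \<in> Field r \<Longrightarrow> Well_order (ht_ord x)"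
  using kurepa by (auto simp: kurepa_tree_def is_tree_def)

lemma refl_r: "x \<in> Field r \<Longrightarrow> (x, x) \<in> r"
  and trans_r: "(x, y) \<in> r \<Longrightarrow> (y, z) \<in> r \<Longrightarrow> (x, z) \<in> r"
  and antisym_r: "(x, y) \<in> r \<Longrightarrow> (y, x) \<in> r \<Longrightarrow> x = y"
  using Partial_order_r unfolding partial_order_on_def preorder_on_def
  by (meson refl_onD transD antisymD)+

lemma underS_Field: "x \<in> underS r y \<Longrightarrow> x \<in> Field r"
  by (auto simp: underS_def Field_def)

text \<open>A node of height at least \<open>omega1\<close> would be, or lie above, a node of height
  exactly \<open>omega1\<close>, but that level is empty.\<close>

lemma ht_less_omega1:
  assumes "x \<in> Field r"
  shows "ht_ord x <o omega1"
proof (rule ccontr)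
  assume "\<not> ht_ord x <o omega1"
  then have "omega1 \<le>o ht_ord x"
    using Well_order_ht[OF assms] Well_order_omega1 not_ordLess_iff_ordLeq by blast
  have "level r omega1 = {}"
    using kurepa by (simp add: kurepa_tree_def has_height_def)
  then have no: "\<not> ht_ord y =o omega1" if "y \<in> Field r" for y
    using that by (auto simp: level_def)
  have "omega1 <o ht_ord x"
    using \<open>omega1 \<le>o ht_ord x\<close> no[OF assms] ordIso_symmetric ordLeq_iff_ordLess_or_ordIso by blast
  then obtain y where "y \<in> underS r x" "omega1 =o ht_ord y"
    using Restr_underS_less_iff[OF Partial_order_r Well_order_ht[OF assms] Well_order_omega1] by blast
  then show False
    using no[OF underS_Field] ordIso_symmetric by blast
qed

definition ht :: "'a \<Rightarrow> ord1" where
  "ht x = (SOME \<alpha>. ht_ord x =o seg \<alpha>)"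

lemma ht: "x \<in> Field r \<Longrightarrow> ht_ord x =o seg (ht x)"
  unfolding ht_def by (rule someI_ex) (rule ex_seg[OF Well_order_ht ht_less_omega1])

lemma ht_mono:
  assumes "(x, y) \<in> r" "x \<noteq> y"
  shows "ht x < ht y"
proof -
  have xy: "x \<in> Field r" "y \<in> Field r" "x \<in> underS r y"
    using assms by (auto simp: Field_def underS_def)
  then have "ht_ord x <o ht_ord y"
    using Restr_underS_less_iff[OF Partial_order_r Well_order_ht Well_order_ht]
      ordIso_reflexive[OF Well_order_ht[of x]] by blast
  then have "seg (ht x) <o seg (ht y)"
    using ht xy ordIso_ordLess_trans ordIso_symmetric ordLess_ordIso_trans by metis
  then show ?thesis
    by (simp add: seg_less_iff)
qed

lemma ex_below:
  assumes "y \<in> Field r" "\<alpha> < ht y"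
  shows "\<exists>x. (x, y) \<in> r \<and> ht x = \<alpha>"
proof -
  have "seg \<alpha> <o ht_ord y"
    using seg_less[OF assms(2)] ht[OF assms(1)] ordIso_symmetric ordLess_ordIso_trans by blast
  then obtain x where x: "x \<in> underS r y" "seg \<alpha> =o ht_ord x"
    using Restr_underS_less_iff[OF Partial_order_r Well_order_ht[OF assms(1)] Well_order_seg] by blast
  then have "seg \<alpha> =o seg (ht x)"
    using ht[OF underS_Field] ordIso_transitive by blast
  then show ?thesis
    using x by (auto simp: seg_iso_iff underS_def)
qed

text \<open>The level clause of \<open>kurepa_tree\<close> speaks of well-orders on the type of
  nodes, while \<open>seg \<alpha>\<close> is one on another type; the height of one node of the
  level serves as representative.\<close>

lemma countable_ht: "countable {x \<in> Field r. ht x = \<alpha>}"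
proof (cases "\<exists>x0\<in>Field r. ht x0 = \<alpha>")
  case True
  then obtain x0 where x0: "x0 \<in> Field r" "ht x0 = \<alpha>"
    by blast
  have "{x \<in> Field r. ht x = \<alpha>} \<subseteq> level r (ht_ord x0)"
  proof
    fix x assume "x \<in> {x \<in> Field r. ht x = \<alpha>}"
    then have "x \<in> Field r" "ht_ord x =o seg \<alpha>"
      using ht[of x] by auto
    moreover have "seg \<alpha> =o ht_ord x0"
      using ordIso_symmetric[OF ht[OF x0(1)]] x0(2) by simp
    ultimately show "x \<in> level r (ht_ord x0)"
      unfolding level_def using ordIso_transitive by blast
  qed
  moreover have "countable (level r (ht_ord x0))"
    using kurepa Well_order_ht[OF x0(1)] by (simp add: kurepa_tree_def)
  ultimately show ?thesis
    using countable_subset by blast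
next
  case False
  then have "{x \<in> Field r. ht x = \<alpha>} = {}"
    by blast
  then show ?thesis
    by (metis countable_empty)
qed

lemma countable_ht_less: "countable {x \<in> Field r. ht x < \<alpha>}"
proof (rule countable_subset)
  show "{x \<in> Field r. ht x < \<alpha>} \<subseteq> (\<Union>\<beta>\<in>{..<\<alpha>}. {x \<in> Field r. ht x = \<beta>})"
    by blast
  show "countable (\<Union>\<beta>\<in>{..<\<alpha>}. {x \<in> Field r. ht x = \<beta>})"
    using countable_ht by (intro countable_UN countable_lessThan_ord1)
qed

lemma ex_numbering:
  obtains j :: "'a \<Rightarrow> ord1" where "inj_on j (Field r)"
proof -
  have "|\<Union>\<alpha>\<in>UNIV. {x \<in> Field r. ht x = \<alpha>}| \<le>o |UNIV :: ord1 set|"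
  proof (rule card_of_UNION_ordLeq_infinite[OF infinite_ord1])
    show "\<forall>\<alpha>\<in>UNIV. |{x \<in> Field r. ht x = \<alpha>}| \<le>o |UNIV :: ord1 set|"
    proof
      fix \<alpha>
      have "|{x \<in> Field r. ht x = \<alpha>}| <o omega1"
        using countable_ht countable_iff_ordLess_omega1 by blast
      then show "|{x \<in> Field r. ht x = \<alpha>}| \<le>o |UNIV :: ord1 set|"
        by (rule ordLess_imp_ordLeq[OF ordLess_ordIso_trans[OF _ ordIso_symmetric[OF card_of_ord1]]])
    qed
  qed (rule ordLeq_reflexive, rule card_of_Well_order)
  moreover have "(\<Union>\<alpha>\<in>UNIV. {x \<in> Field r. ht x = \<alpha>}) = Field r"
    by blast
  ultimately have "|Field r| \<le>o |UNIV :: ord1 set|"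
    by simp
  then show ?thesis
    using that card_of_ordLeq[of "Field r" "UNIV :: ord1 set"] by blast
qed

section \<open>Uncountable branches\<close>

lemma branch_Field:
  assumes "branch r b" "x \<in> b"
  shows "x \<in> Field r"
  using assms by (auto simp: branch_def Chains_def Field_def)

lemma branch_comparable:
  assumes "branch r b" "x \<in> b" "y \<in> b"
  shows "(x, y) \<in> r \<or> (y, x) \<in> r"
  using assms by (auto simp: branch_def Chains_def)

text \<open>By maximality it suffices that \<open>x\<close> is comparable with every
  \<open>z\<close> of the branch. The critical case is \<open>z\<close> below \<open>y\<close>: then
  \<open>x\<close> and \<open>z\<close> lie in the well-ordered set of predecessors of
  \<open>y\<close>.\<close>

lemma branch_downward:
  assumes b: "branch r b" and y: "y \<in> b" and xy: "(x, y) \<in> r"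
  shows "x \<in> b"
proof -
  have "(x, z) \<in> r \<or> (z, x) \<in> r" if "z \<in> b" for z
  proof (cases "(y, z) \<in> r \<or> x = y \<or> z = y")
    case True
    then show ?thesis
      using trans_r[OF xy, of z] branch_comparable[OF b y that] xy by auto
  next
    case False
    then have "x \<in> underS r y" "z \<in> underS r y"
      using xy branch_comparable[OF b y that] by (auto simp: underS_def)
    then have "x \<in> Field (ht_ord y)" "z \<in> Field (ht_ord y)"
      unfolding Field_Restr_underS[OF Partial_order_r] .
    moreover have "total_on (Field (ht_ord y)) (ht_ord y)" "refl_on (Field (ht_ord y)) (ht_ord y)"
      using Well_order_ht[OF branch_Field[OF b y]]
      by (auto simp: well_order_on_def linear_order_on_def partial_order_on_def preorder_on_def)
    ultimately have "(x, z) \<in> ht_ord y \<or> (z, x) \<in> ht_ord y"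
      unfolding total_on_def refl_on_def by metis
    then show ?thesis
      by blast
  qed
  moreover have "(x, x) \<in> r"
    using xy by (intro refl_r) (auto simp: Field_def)
  ultimately have "insert x b \<in> Chains r"
    using b by (auto simp: branch_def Chains_def)
  then show ?thesis
    using b unfolding branch_def by blast
qed

text \<open>Only countably many nodes have height less than \<alpha>, so the branch contains a node
  at or above that level; downward closure does the rest.\<close>

lemma branch_meets_level:
  assumes b: "branch r b" "uncountable b"
  shows "\<exists>x\<in>b. ht x = \<alpha>"
proof -
  have "b \<subseteq> Field r"
    using branch_Field[OF b(1)] by blast
  have "\<not> b \<subseteq> {x \<in> Field r. ht x < \<alpha>}"
    using b(2) countable_ht_less countable_subset by blast
  then obtain y where y: "y \<in> b" "\<alpha> \<le> ht y"
    using \<open>b \<subseteq> Field r\<close> by (auto simp flip: not_less)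
  show ?thesis
  proof (cases "\<alpha> = ht y")
    case False
    then have "y \<in> Field r" "\<alpha> < ht y"
      using y \<open>b \<subseteq> Field r\<close> by (auto simp: order_less_le)
    then obtain x where "(x, y) \<in> r" "ht x = \<alpha>"
      using ex_below by blast
    then show ?thesis
      using branch_downward[OF b(1) y(1)] by blast
  qed (use y in blast)
qed

lemma branch_below_iff:
  assumes b: "branch r b" and x: "x \<in> b" and z: "ht z < ht x"
  shows "z \<in> b \<longleftrightarrow> (z, x) \<in> r"
proof
  assume "z \<in> b"
  then show "(z, x) \<in> r"
    using branch_comparable[OF b x] ht_mono[of x z] z by (cases "x = z") (auto dest: less_asym)
qed (use branch_downward[OF b x] in blast)

text \<open>A node of \<open>b\<close> outside \<open>b'\<close> cannot lie below a common node, so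
  all common nodes lie below it.\<close>

lemma branches_diverge:
  assumes "branch r b" "branch r b'" "b \<noteq> b'"
  shows "\<exists>\<alpha>. \<forall>z \<in> b \<inter> b'. ht z < \<alpha>"
proof -
  have "\<not> b \<subseteq> b'"
    using assms by (auto simp: branch_def)
  then obtain x where x: "x \<in> b" "x \<notin> b'"
    by blast
  have "ht z < ht x" if "z \<in> b \<inter> b'" for z
  proof -
    have "(x, z) \<notin> r"
      using branch_downward[OF assms(2), of z x] that x by blast
    then have "(z, x) \<in> r" "z \<noteq> x"
      using branch_comparable[OF assms(1), of x z] x that by auto
    then show ?thesis
      by (rule ht_mono)
  qed
  then show ?thesis
    by blast
qed

lemma ex_kurepa_family:
  obtains A :: "ord2 \<Rightarrow> ord1 set" where
    "\<And>k. uncountable (A k)"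
    "\<And>\<delta>. countable (range (\<lambda>k. A k \<inter> {..<\<delta>}))"
    "\<And>F. countable F \<Longrightarrow> \<exists>\<gamma>. \<forall>k\<in>F. \<forall>l\<in>F. k \<noteq> l \<longrightarrow> A k \<inter> A l \<subseteq> {..<\<gamma>}"
proof -
  obtain j :: "'a \<Rightarrow> ord1" where j: "inj_on j (Field r)"
    by (rule ex_numbering)
  have "omega2 \<le>o |{b. branch r b \<and> uncountable b}|"
    using kurepa by (simp add: kurepa_tree_def)
  then have "|UNIV :: ord2 set| \<le>o |{b. branch r b \<and> uncountable b}|"
    using card_of_ord2 ordIso_ordLeq_trans by blast
  then obtain f :: "ord2 \<Rightarrow> 'a set" where "inj f" "range f \<subseteq> {b. branch r b \<and> uncountable b}"
    using card_of_ordLeq[of "UNIV :: ord2 set" "{b. branch r b \<and> uncountable b}"] by blast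
  then have f: "inj f" "\<And>k. branch r (f k)" "\<And>k. uncountable (f k)"
    by blast+
  have sub: "f k \<subseteq> Field r" for k
    using branch_Field[OF f(2)] by blast
  show ?thesis
  proof (rule that[of "\<lambda>k. j ` f k"])
    fix k
    show "uncountable (j ` f k)"
      using f(3) inj_on_subset[OF j sub] by (simp add: countable_image_inj_eq)
  next
    fix \<delta>
    \<comment> \<open>Countably many nodes have a number below \<delta>, so their heights are
      bounded by some \<alpha>. What a branch contains of \<open>D\<close> is fixed by its node at
      level \<alpha>, and that level is countable.\<close>
    define D where "D = {x \<in> Field r. j x < \<delta>}"
    have "countable (j ` D)"
      by (rule countable_subset[OF _ countable_lessThan_ord1[of \<delta>]]) (auto simp: D_def)
    then have "countable D"
      by (rule countable_image_inj_on) (rule inj_on_subset[OF j], auto simp: D_def)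
    then have "countable (ht ` D)"
      by (rule countable_image)
    then obtain \<alpha> where "\<And>\<beta>. \<beta> \<in> ht ` D \<Longrightarrow> \<beta> < \<alpha>"
      using countable_bound_ord1 by metis
    then have \<alpha>: "ht x < \<alpha>" if "x \<in> D" for x
      using that by blast
    have "j ` f k \<inter> {..<\<delta>} \<in> (\<lambda>x. j ` {z \<in> D. (z, x) \<in> r}) ` {x \<in> Field r. ht x = \<alpha>}" for k
    proof -
      obtain x where x: "x \<in> f k" "ht x = \<alpha>"
        using branch_meets_level[OF f(2,3)] by blast
      have "j ` f k \<inter> {..<\<delta>} = j ` (f k \<inter> D)"
        using sub by (auto simp: D_def)
      also have "f k \<inter> D = {z \<in> D. (z, x) \<in> r}"
        using branch_below_iff[OF f(2) x(1)] x(2) \<alpha> by blast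
      finally show ?thesis
        using x sub by blast
    qed
    then have "range (\<lambda>k. j ` f k \<inter> {..<\<delta>}) \<subseteq> (\<lambda>x. j ` {z \<in> D. (z, x) \<in> r}) ` {x \<in> Field r. ht x = \<alpha>}"
      by blast
    then show "countable (range (\<lambda>k. j ` f k \<inter> {..<\<delta>}))"
      by (rule countable_subset) (intro countable_image countable_ht)
  next
    fix F :: "ord2 set"
    assume "countable F"
    have "\<forall>c. \<exists>\<alpha>. fst c \<noteq> snd c \<longrightarrow> (\<forall>z \<in> f (fst c) \<inter> f (snd c). ht z < \<alpha>)"
      using branches_diverge[OF f(2) f(2)] f(1) by (simp add: inj_eq)
    then obtain g where g: "\<And>k l z. k \<noteq> l \<Longrightarrow> z \<in> f k \<inter> f l \<Longrightarrow> ht z < g (k, l)"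
      by (metis fst_conv snd_conv)
    have "countable (g ` (F \<times> F))"
      using \<open>countable F\<close> by (intro countable_image countable_SIGMA)
    then obtain \<gamma>0 where "\<And>\<beta>. \<beta> \<in> g ` (F \<times> F) \<Longrightarrow> \<beta> < \<gamma>0"
      using countable_bound_ord1 by metis
    then have \<gamma>0: "g (k, l) < \<gamma>0" if "k \<in> F" "l \<in> F" for k l
      using that by blast
    \<comment> \<open>\<open>\<gamma>0\<close> bounds the heights of all common nodes. As only
      countably many nodes lie below that level, their numbers are bounded too.\<close>
    have "countable (j ` {x \<in> Field r. ht x < \<gamma>0})"
      by (intro countable_image countable_ht_less)
    then obtain \<gamma> where "\<And>\<beta>. \<beta> \<in> j ` {x \<in> Field r. ht x < \<gamma>0} \<Longrightarrow> \<beta> < \<gamma>"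
      using countable_bound_ord1 by metis
    then have \<gamma>: "j x < \<gamma>" if "x \<in> Field r" "ht x < \<gamma>0" for x
      using that by blast
    have "j ` f k \<inter> j ` f l \<subseteq> {..<\<gamma>}" if "k \<in> F" "l \<in> F" "k \<noteq> l" for k l
    proof -
      have "j ` f k \<inter> j ` f l = j ` (f k \<inter> f l)"
        using inj_on_image_Int[OF j sub sub] by simp
      moreover have "j z < \<gamma>" if "z \<in> f k \<inter> f l" for z
        using g[OF \<open>k \<noteq> l\<close> that] \<gamma>0[OF \<open>k \<in> F\<close> \<open>l \<in> F\<close>] that sub by (intro \<gamma>) (auto intro: less_trans)
      ultimately show ?thesis
        by auto
    qed
    then show "\<exists>\<gamma>. \<forall>k\<in>F. \<forall>l\<in>F. k \<noteq> l \<longrightarrow> j ` f k \<inter> j ` f l \<subseteq> {..<\<gamma>}"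
      by blast
  qed
qed

end

section \<open>Heisenberg groups\<close>

lemma (in group) centralizer_subgroup:
  assumes "X \<subseteq> carrier G"
  shows "subgroup {g \<in> carrier G. \<forall>x\<in>X. g \<otimes> x = x \<otimes> g} G"
proof (rule subgroupI)
  fix g assume g: "g \<in> {g \<in> carrier G. \<forall>x\<in>X. g \<otimes> x = x \<otimes> g}"
  have "inv g \<otimes> x = x \<otimes> inv g" if "x \<in> X" for x
  proof -
    have "x \<in> carrier G" "g \<in> carrier G" "x \<otimes> g = g \<otimes> x"
      using that g assms by auto
    then show ?thesis
      by (metis inv_closed inv_solve_left inv_solve_right m_assoc m_closed)
  qed
  then show "inv g \<in> {g \<in> carrier G. \<forall>x\<in>X. g \<otimes> x = x \<otimes> g}"
    using g by auto
next
  fix g h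
  assume "g \<in> {g \<in> carrier G. \<forall>x\<in>X. g \<otimes> x = x \<otimes> g}" "h \<in> {g \<in> carrier G. \<forall>x\<in>X. g \<otimes> x = x \<otimes> g}"
  then show "g \<otimes> h \<in> {g \<in> carrier G. \<forall>x\<in>X. g \<otimes> x = x \<otimes> g}"
    using assms by (auto simp: subset_iff) (metis m_assoc)
qed (use assms in \<open>auto simp: subset_iff\<close>)

text \<open>\<open>A\<close> and \<open>x\<close> generate an abelian subgroup: the generators
  commute, so they centralize all they generate, and hence so does the generated subgroup.
  Maximality puts it inside \<open>A\<close>.\<close>

lemma (in group) maximal_abelian_self_centralizing:
  assumes A: "maximal_abelian_subgroup A G"
    and x: "x \<in> carrier G" "\<And>a. a \<in> A \<Longrightarrow> x \<otimes> a = a \<otimes> x"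
  shows "x \<in> A"
proof -
  have sub: "subgroup A G" and comm: "comm_group (G\<lparr>carrier := A\<rparr>)"
    using A by (auto simp: maximal_abelian_subgroup_def abelian_subgroup_def)
  have comm_A: "a \<otimes> b = b \<otimes> a" if "a \<in> A" "b \<in> A" for a b
    using comm_monoid.m_comm[OF comm_group.axioms(1)[OF comm]] that by auto
  define H where "H = insert x A"
  define C where "C X = {g \<in> carrier G. \<forall>x\<in>X. g \<otimes> x = x \<otimes> g}" for X
  have H: "H \<subseteq> carrier G"
    using x(1) subgroup.subset[OF sub] by (auto simp: H_def)
  have "H \<subseteq> C H"
    using H x(2) comm_A by (auto simp: H_def C_def)
  then have "generate G H \<subseteq> C H"
    using centralizer_subgroup[OF H] by (intro generate_subgroup_incl) (auto simp: C_def)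
  then have "H \<subseteq> C (generate G H)"
    using H by (fastforce simp: C_def)
  then have sub': "generate G H \<subseteq> C (generate G H)"
    using centralizer_subgroup[OF generate_incl[OF H]] by (intro generate_subgroup_incl) (auto simp: C_def)
  have "subgroup (generate G H) G"
    using generate_is_subgroup[OF H] .
  moreover have "comm_group (G\<lparr>carrier := generate G H\<rparr>)"
    using sub' by (intro group.group_comm_groupI[OF subgroup.subgroup_is_group[OF calculation is_group]])
      (auto simp: C_def)
  moreover have "A \<subseteq> generate G H" "x \<in> generate G H"
    by (auto simp: H_def intro: generate.incl)
  ultimately show ?thesis
    using A unfolding maximal_abelian_subgroup_def abelian_subgroup_def by blast
qed

text \<open>An element is named \<open>mk v a\<close> by a vector modulo \<open>N\<close> and an
  integer modulo \<open>p\<close>, with \<open>B\<close> as cocycle. Leaving \<open>mk\<close> a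
  parameter allows the carrier to be a prescribed set.\<close>

locale heisenberg =
  fixes p :: nat and B :: "'v :: ab_group_add \<Rightarrow> 'v \<Rightarrow> int" and N :: "'v set"
    and mk :: "'v \<Rightarrow> int \<Rightarrow> 'g"
  assumes prime_p: "prime p"
    and B_add_left: "B (v + v') w = B v w + B v' w"
    and B_add_right: "B v (w + w') = B v w + B v w'"
    and B_null_left: "n \<in> N \<Longrightarrow> int p dvd B n w"
    and B_null_right: "n \<in> N \<Longrightarrow> int p dvd B v n"
    and N_diff: "n \<in> N \<Longrightarrow> n' \<in> N \<Longrightarrow> n - n' \<in> N"
    and mk_eq_iff: "mk v a = mk w b \<longleftrightarrow> v - w \<in> N \<and> int p dvd a - b"
    and nondegenerate: "(\<And>w. int p dvd B v w - B w v) \<Longrightarrow> v \<in> N"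
    and torsion: "(\<Sum>i<p. v) \<in> N"
    and nontrivial: "\<exists>v. v \<notin> N"
begin

definition rep :: "'g \<Rightarrow> 'v \<times> int" where
  "rep x = (SOME z. mk (fst z) (snd z) = x)"

definition G :: "'g monoid" where
  "G = \<lparr>carrier = {mk v a | v a. True},
        monoid.mult = (\<lambda>x y. mk (fst (rep x) + fst (rep y))
                   (snd (rep x) + snd (rep y) + B (fst (rep x)) (fst (rep y)))),
        one = mk 0 0\<rparr>"

lemma zero_N [simp]: "0 \<in> N"
  using mk_eq_iff[of 0 0 0 0] by simp

lemma N_add: "n \<in> N \<Longrightarrow> n' \<in> N \<Longrightarrow> n + n' \<in> N"
  using N_diff[of n "0 - n'"] N_diff[of 0 n'] by simp

lemma B_zero [simp]: "B 0 w = 0" "B v 0 = 0"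
  using B_add_left[of 0 0 w] B_add_right[of v 0 0] by simp_all

lemma B_minus [simp]: "B (- v) w = - B v w" "B v (- w) = - B v w"
  using B_add_left[of v "- v" w] B_add_right[of v w "- w"] by simp_all

lemma B_diff: "B (v - v') w = B v w - B v' w" "B v (w - w') = B v w - B v w'"
  using B_add_left[of v "- v'" w] B_add_right[of v w "- w'"] by simp_all

lemma B_sum: "B (\<Sum>i<n. v) w = int n * B v w" "B v (\<Sum>i<n. w) = int n * B v w"
proof -
  show "B (\<Sum>i<n. v) w = int n * B v w"
    by (induction n) (simp_all add: B_add_left algebra_simps)
  show "B v (\<Sum>i<n. w) = int n * B v w"
    by (induction n) (simp_all add: B_add_right algebra_simps)
qed

lemma mk_null: "v \<in> N \<Longrightarrow> mk v a = mk 0 a"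
  by (simp add: mk_eq_iff)

lemma carrierE:
  assumes "x \<in> carrier G"
  obtains v a where "x = mk v a"
  using assms by (auto simp: G_def)

lemma mk_carrier [simp]: "mk v a \<in> carrier G"
  by (auto simp: G_def)

lemma one_mk: "\<one>\<^bsub>G\<^esub> = mk 0 0"
  by (simp add: G_def)

text \<open>The choices in \<open>rep\<close> do not matter: names of one element differ by an
  element of \<open>N\<close> and a multiple of \<open>p\<close>, and \<open>B\<close> is divisible
  by \<open>p\<close> if one argument is in \<open>N\<close>.\<close>

lemma mult_mk [simp]: "mk v a \<otimes>\<^bsub>G\<^esub> mk w b = mk (v + w) (a + b + B v w)"
proof -
  obtain v' a' w' b' where rep: "rep (mk v a) = (v', a')" "rep (mk w b) = (w', b')"
    by (metis surj_pair)
  have "mk (fst (rep (mk v a))) (snd (rep (mk v a))) = mk v a" for v a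
    unfolding rep_def by (rule someI[of _ "(v, a)"]) simp
  from this[of v a] this[of w b]
  have *: "v' - v \<in> N" "int p dvd a' - a" "w' - w \<in> N" "int p dvd b' - b"
    unfolding rep by (simp_all add: mk_eq_iff)
  have "v' + w' - (v + w) \<in> N"
    using N_add[OF *(1,3)] by (simp add: algebra_simps)
  moreover have "int p dvd (a' - a) + (b' - b) + B (v' - v) w' + B v (w' - w)"
    using * by (intro dvd_add B_null_left B_null_right)
  then have "int p dvd a' + b' + B v' w' - (a + b + B v w)"
    by (simp add: B_diff algebra_simps)
  ultimately show ?thesis
    by (simp add: G_def rep mk_eq_iff)
qed

lemma group_G: "group G"
proof (rule groupI)
  fix x assume "x \<in> carrier G"
  then obtain v a where x: "x = mk v a"
    by (rule carrierE)
  show "\<one>\<^bsub>G\<^esub> \<otimes>\<^bsub>G\<^esub> x = x"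
    by (simp add: x one_mk)
  have "mk (- v) (- a + B v v) \<otimes>\<^bsub>G\<^esub> x = \<one>\<^bsub>G\<^esub>"
    by (simp add: x one_mk)
  then show "\<exists>y\<in>carrier G. y \<otimes>\<^bsub>G\<^esub> x = \<one>\<^bsub>G\<^esub>"
    using mk_carrier by blast
qed (auto simp: one_mk B_add_left B_add_right algebra_simps elim!: carrierE)

sublocale group G
  by (rule group_G)

lemma inv_mk: "inv\<^bsub>G\<^esub> (mk v a) = mk (- v) (- a + B v v)"
  by (rule inv_equality) (simp_all add: one_mk)

lemma pow_mk: "\<exists>b. mk v a [^]\<^bsub>G\<^esub> n = mk (\<Sum>i<n. v) b" for n :: nat
proof (induction n)
  case 0
  then show ?case
    by (auto simp: one_mk)
next
  case (Suc n)
  then show ?case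
    by auto
qed

lemma pow_mk_0: "mk 0 a [^]\<^bsub>G\<^esub> n = mk 0 (int n * a)" for n :: nat
  by (induction n) (simp_all add: one_mk algebra_simps)

lemma mk_commute_iff:
  "mk v a \<otimes>\<^bsub>G\<^esub> mk w b = mk w b \<otimes>\<^bsub>G\<^esub> mk v a \<longleftrightarrow> int p dvd B v w - B w v"
  by (simp add: mk_eq_iff algebra_simps)

lemma commutator_mk:
  "mk v a \<otimes>\<^bsub>G\<^esub> mk w b \<otimes>\<^bsub>G\<^esub> inv\<^bsub>G\<^esub> (mk v a) \<otimes>\<^bsub>G\<^esub> inv\<^bsub>G\<^esub> (mk w b) = mk 0 (B v w - B w v)"
  by (simp add: inv_mk B_add_left B_add_right algebra_simps)

section \<open>Centre, derived subgroup and Frattini subgroup\<close>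

lemma centre_eq: "centre G = range (mk 0)"
proof (intro equalityI subsetI)
  fix z assume z: "z \<in> centre G"
  then obtain v a where va: "z = mk v a"
    by (auto simp: centre_def elim: carrierE)
  have "v \<in> N"
  proof (rule nondegenerate)
    fix w
    show "int p dvd B v w - B w v"
      using z mk_carrier[of w 0] mk_commute_iff[of v a w 0] by (simp add: centre_def va del: mult_mk)
  qed
  then show "z \<in> range (mk 0)"
    using mk_null[of v a] by (simp add: va)
next
  fix z assume "z \<in> range (mk 0)"
  then show "z \<in> centre G"
    by (auto simp: centre_def algebra_simps elim!: carrierE)
qed

lemma ex_noncommuting: "\<exists>v w. \<not> int p dvd B v w - B w v"
  using nontrivial nondegenerate by blast

text \<open>\<open>c\<close> is invertible modulo the prime \<open>p\<close>. The multiplier is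
  natural because it serves as an exponent of group elements.\<close>

lemma dvd_multiple:
  assumes "\<not> int p dvd c"
  shows "\<exists>n :: nat. int p dvd a - int n * c"
proof -
  have "coprime c (int p)"
    using prime_imp_coprime[of "int p" c] assms prime_p by (simp add: coprime_commute)
  then obtain x where x: "[c * x = 1] (mod int p)"
    using cong_solve_coprime_int by blast
  have "p > 0"
    using prime_p prime_gt_0_nat by blast
  have "[int (nat ((x * a) mod int p)) * c = (x * a) * c] (mod int p)"
    using \<open>p > 0\<close> by (intro cong_mult) (simp_all add: cong_def)
  also have "[(x * a) * c = 1 * a] (mod int p)"
    using cong_mult[OF x cong_refl[of a]] by (simp add: mult_ac)
  finally have "int p dvd a - int (nat ((x * a) mod int p)) * c"
    unfolding cong_iff_dvd_diff by (metis dvd_diff_commute mult_1)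
  then show ?thesis
    by blast
qed

lemma centre_subset:
  assumes H: "subgroup H G" and c: "mk 0 c \<in> H" "\<not> int p dvd c"
  shows "centre G \<subseteq> H"
proof -
  have "mk 0 a \<in> H" for a
  proof -
    obtain n :: nat where "int p dvd a - int n * c"
      using dvd_multiple[OF c(2)] by blast
    then have "mk 0 a = mk 0 c [^]\<^bsub>G\<^esub> n"
      by (simp add: pow_mk_0 mk_eq_iff)
    moreover have "mk 0 c [^]\<^bsub>G\<^esub> n \<in> H"
      by (induction n) (use H c in \<open>auto intro: subgroup.one_closed subgroup.m_closed\<close>)
    ultimately show ?thesis
      by simp
  qed
  then show ?thesis
    by (auto simp: centre_eq)
qed

lemma subgroup_centre: "subgroup (centre G) G"
  unfolding centre_def by (rule centralizer_subgroup) simp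

lemma derived_eq: "derived G (carrier G) = centre G"
proof (rule equalityI)
  show "derived G (carrier G) \<subseteq> centre G"
    unfolding derived_def
    by (rule generate_subgroup_incl[OF _ subgroup_centre])
      (auto simp: commutator_mk centre_eq simp del: mult_mk elim!: carrierE)
  obtain v w where "\<not> int p dvd B v w - B w v"
    using ex_noncommuting by blast
  moreover have "mk 0 (B v w - B w v) \<in> derived G (carrier G)"
    unfolding derived_def commutator_mk[of v 0 w 0, symmetric]
    by (intro generate.incl UN_I[of "mk v 0"] UN_I[of "mk w 0"] singletonI mk_carrier)
  moreover have "subgroup (derived G (carrier G)) G"
    by (rule derived_is_subgroup) simp
  ultimately show "centre G \<subseteq> derived G (carrier G)"
    using centre_subset by blast
qed

text \<open>Otherwise the product \<open>K\<close> of \<open>M\<close> and the centre is the whole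
  group by maximality. Commutators ignore central factors, so \<open>M\<close> contains a nontrivial
  one and with it the centre.\<close>

lemma centre_subset_maximal:
  assumes M: "maximal_subgroup M G"
  shows "centre G \<subseteq> M"
proof (rule ccontr)
  assume nsub: "\<not> centre G \<subseteq> M"
  have sub: "subgroup M G"
    using M by (simp add: maximal_subgroup_def)
  define K where "K = {mk v a | v a. \<exists>b. mk v b \<in> M}"
  have K_iff: "mk v a \<in> K \<longleftrightarrow> (\<exists>b. mk v b \<in> M)" for v a
  proof
    assume "mk v a \<in> K"
    then obtain w c b where "mk v a = mk w c" "mk w b \<in> M"
      by (auto simp: K_def)
    then have "mk v b \<in> M"
      using mk_eq_iff[of v a w c] mk_eq_iff[of v b w b] by simp
    then show "\<exists>b. mk v b \<in> M" ..
  qed (auto simp: K_def)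
  have "subgroup K G"
  proof (rule subgroupI)
    show "K \<subseteq> carrier G"
      by (auto simp: K_def)
    show "K \<noteq> {}"
      using subgroup.one_closed[OF sub] K_iff[of 0 0] by (auto simp: one_mk)
  next
    fix x assume "x \<in> K"
    then obtain v a b where "x = mk v a" "mk v b \<in> M"
      by (auto simp: K_def)
    then show "inv\<^bsub>G\<^esub> x \<in> K"
      using subgroup.m_inv_closed[OF sub, of "mk v b"] by (auto simp: inv_mk K_iff)
  next
    fix x y assume "x \<in> K" "y \<in> K"
    then obtain v a b w c d where "x = mk v a" "mk v b \<in> M" "y = mk w c" "mk w d \<in> M"
      by (auto simp: K_def)
    then show "x \<otimes>\<^bsub>G\<^esub> y \<in> K"
      using subgroup.m_closed[OF sub, of "mk v b" "mk w d"] by (auto simp: K_iff)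
  qed
  moreover have "M \<subseteq> K"
  proof
    fix x assume "x \<in> M"
    moreover from this obtain v a where "x = mk v a"
      using subgroup.subset[OF sub] carrierE by blast
    ultimately show "x \<in> K"
      by (auto simp: K_iff)
  qed
  moreover have "centre G \<subseteq> K"
    using subgroup.one_closed[OF sub] by (auto simp: centre_eq K_iff one_mk)
  ultimately have "K = carrier G"
    using M nsub unfolding maximal_subgroup_def by blast
  then have lift: "\<exists>b. mk v b \<in> M" for v
    unfolding K_iff[of v 0, symmetric] by simp
  obtain v w where vw: "\<not> int p dvd B v w - B w v"
    using ex_noncommuting by blast
  obtain a b where "mk v a \<in> M" "mk w b \<in> M"
    using lift by blast
  then have "mk 0 (B v w - B w v) \<in> M"
    unfolding commutator_mk[of v a w b, symmetric]
    using sub by (intro subgroup.m_closed subgroup.m_inv_closed)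
  then show False
    using centre_subset[OF sub] vw nsub by blast
qed

text \<open>Some \<open>w\<close> pairs nontrivially with the vector of \<open>x\<close>. Pairing
  with \<open>w\<close> is a homomorphism to the residues modulo \<open>p\<close>, and its kernel is
  maximal since the quotient has prime order.\<close>

lemma ex_maximal_avoiding:
  assumes "x \<in> carrier G" "x \<notin> centre G"
  shows "\<exists>M. maximal_subgroup M G \<and> x \<notin> M"
proof -
  obtain v a where x: "x = mk v a"
    using assms(1) by (rule carrierE)
  have "v \<notin> N"
    using assms(2) mk_null[of v a] by (auto simp: x centre_eq)
  then obtain w where w: "\<not> int p dvd B v w - B w v"
    using nondegenerate by blast
  define \<phi> where "\<phi> u = B u w - B w u" for u
  have \<phi>: "\<phi> (u + u') = \<phi> u + \<phi> u'" "\<phi> (- u) = - \<phi> u" "\<phi> 0 = 0" for u u'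
    by (simp_all add: \<phi>_def B_add_left B_add_right)
  define M where "M = {mk u b | u b. int p dvd \<phi> u}"
  have M_iff: "mk u b \<in> M \<longleftrightarrow> int p dvd \<phi> u" for u b
  proof
    assume "mk u b \<in> M"
    then obtain u' b' where "mk u b = mk u' b'" "int p dvd \<phi> u'"
      by (auto simp: M_def)
    moreover from this have "int p dvd \<phi> (u - u')"
      unfolding \<phi>_def by (intro dvd_diff B_null_left B_null_right) (simp_all add: mk_eq_iff)
    ultimately have "int p dvd \<phi> ((u - u') + u')"
      unfolding \<phi>(1) by (intro dvd_add)
    then show "int p dvd \<phi> u"
      by simp
  qed (auto simp: M_def)
  have sub: "subgroup M G"
  proof (rule subgroupI)
    show "M \<subseteq> carrier G"
      by (auto simp: M_def)
    have "mk 0 0 \<in> M"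
      by (simp add: M_iff \<phi>)
    then show "M \<noteq> {}"
      by blast
  next
    fix x assume "x \<in> M"
    then obtain u b where "x = mk u b" "int p dvd \<phi> u"
      by (auto simp: M_def)
    then show "inv\<^bsub>G\<^esub> x \<in> M"
      by (simp add: inv_mk M_iff \<phi>)
  next
    fix x y assume "x \<in> M" "y \<in> M"
    then obtain u b u' b' where "x = mk u b" "int p dvd \<phi> u" "y = mk u' b'" "int p dvd \<phi> u'"
      by (auto simp: M_def)
    then show "x \<otimes>\<^bsub>G\<^esub> y \<in> M"
      by (simp add: M_iff \<phi>)
  qed
  have "x \<notin> M"
    using w by (simp add: x M_iff \<phi>_def)
  moreover have "K = carrier G" if K: "subgroup K G" "M \<subseteq> K" "K \<noteq> M" for K
  proof -
    obtain y where y: "y \<in> K" "y \<notin> M"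
      using K by blast
    then obtain u b where ub: "y = mk u b"
      using subgroup.subset[OF K(1)] carrierE by blast
    have "mk s d \<in> K" for s d
    proof -
      \<comment> \<open>A suitable power of \<open>y\<close> cancels the value of
        \<open>\<phi>\<close> at \<open>s\<close>, so that the remaining factor lies in
        \<open>M\<close>.\<close>
      obtain n :: nat where n: "int p dvd \<phi> s - int n * \<phi> u"
        using dvd_multiple[of "\<phi> u" "\<phi> s"] y ub M_iff by auto
      obtain b' where b': "y [^]\<^bsub>G\<^esub> n = mk (\<Sum>i<n. u) b'"
        using pow_mk ub by blast
      have yn: "y [^]\<^bsub>G\<^esub> n \<in> K"
        by (induction n) (use K(1) y(1) in \<open>auto intro: subgroup.one_closed subgroup.m_closed\<close>)
      have "\<phi> (s - (\<Sum>i<n. u)) = \<phi> s - int n * \<phi> u"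
        by (simp add: \<phi>_def B_diff B_sum algebra_simps)
      then have "mk (s - (\<Sum>i<n. u)) (d - b' - B (s - (\<Sum>i<n. u)) (\<Sum>i<n. u)) \<in> M"
        using n by (simp add: M_iff)
      then have "mk (s - (\<Sum>i<n. u)) (d - b' - B (s - (\<Sum>i<n. u)) (\<Sum>i<n. u)) \<otimes>\<^bsub>G\<^esub> y [^]\<^bsub>G\<^esub> n \<in> K"
        using K yn by (intro subgroup.m_closed) auto
      then show ?thesis
        by (simp add: b')
    qed
    then show ?thesis
      using subgroup.subset[OF K(1)] by (auto elim!: carrierE)
  qed
  ultimately show ?thesis
    using sub assms(1) unfolding maximal_subgroup_def by blast
qed

lemma frattini_eq: "frattini G = centre G"
proof (intro equalityI subsetI)
  fix x assume "x \<in> frattini G"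
  then show "x \<in> centre G"
    using ex_maximal_avoiding by (auto simp: frattini_def)
next
  fix x assume "x \<in> centre G"
  then show "x \<in> frattini G"
    using centre_subset_maximal by (auto simp: frattini_def centre_def)
qed

text \<open>By \<open>torsion\<close> the \<open>p\<close>-th power of every element is central, and
  the centre has exponent \<open>p\<close>; hence all orders divide \<open>p ^ 2\<close>.\<close>

lemma p_group_G: "p_group p G"
  unfolding p_group_def
proof (intro conjI ballI)
  fix x assume x: "x \<in> carrier G"
  then obtain v a where va: "x = mk v a"
    by (rule carrierE)
  obtain b where "x [^]\<^bsub>G\<^esub> p = mk (\<Sum>i<p. v) b"
    using pow_mk va by blast
  then have "x [^]\<^bsub>G\<^esub> p = mk 0 b"
    using mk_null[OF torsion] by simp
  then have "(x [^]\<^bsub>G\<^esub> p) [^]\<^bsub>G\<^esub> p = mk 0 (int p * b)"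
    by (simp add: pow_mk_0)
  also have "\<dots> = \<one>\<^bsub>G\<^esub>"
    by (simp add: one_mk mk_eq_iff)
  finally have "x [^]\<^bsub>G\<^esub> (p ^ 2) = \<one>\<^bsub>G\<^esub>"
    using x by (simp add: nat_pow_pow power2_eq_square)
  then have "ord x dvd p ^ 2"
    using x pow_eq_id by blast
  then show "\<exists>k. ord x = p ^ k"
    using divides_primepow_nat[OF prime_p] by blast
qed (rule group_G)

lemma centre_iso: "G\<lparr>carrier := centre G\<rparr> \<cong> integer_mod_group p"
proof -
  have p: "p > 0"
    using prime_p prime_gt_0_nat by blast
  have "mk 0 \<in> iso (integer_mod_group p) (G\<lparr>carrier := centre G\<rparr>)"
  proof (rule isoI)
    show "mk 0 \<in> hom (integer_mod_group p) (G\<lparr>carrier := centre G\<rparr>)"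
      by (auto simp: hom_def centre_eq mk_eq_iff mod_eq_dvd_iff[symmetric])
    have "mk 0 a \<in> mk 0 ` {0..<int p}" for a
      using p by (intro image_eqI[of _ _ "a mod int p"]) (auto simp: mk_eq_iff mod_eq_dvd_iff[symmetric])
    moreover have "inj_on (mk 0) {0..<int p}"
      by (auto simp: inj_on_def mk_eq_iff mod_eq_dvd_iff[symmetric])
    ultimately show "bij_betw (mk 0) (carrier (integer_mod_group p)) (carrier (G\<lparr>carrier := centre G\<rparr>))"
      using p by (auto simp: bij_betw_def centre_eq carrier_integer_mod_group)
  qed
  then have "integer_mod_group p \<cong> G\<lparr>carrier := centre G\<rparr>"
    by (auto simp: is_iso_def)
  then show ?thesis
    by (rule group.iso_sym[OF group_integer_mod_group])
qed

lemma extraspecial_G: "extraspecial p G"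
  unfolding extraspecial_def
  using prime_p p_group_G frattini_eq derived_eq centre_iso by simp

text \<open>As \<open>A\<close> contains every element commuting with it, it is the full preimage of
  \<open>S\<close>, and \<open>S\<close> is its own orthogonal complement. So cosets of
  \<open>A\<close> correspond to cosets of that complement.\<close>

lemma maximal_abelian_isotropic:
  assumes A: "maximal_abelian_subgroup A G"
  defines "S \<equiv> {v. \<exists>a. mk v a \<in> A}"
  shows "\<And>v w. v \<in> S \<Longrightarrow> w \<in> S \<Longrightarrow> v - w \<in> S"
    and "N \<subseteq> S"
    and "\<And>v w. v \<in> S \<Longrightarrow> w \<in> S \<Longrightarrow> int p dvd B v w - B w v"
    and "|rcosets\<^bsub>G\<^esub> A| \<le>o |range (\<lambda>v. {w. \<forall>s\<in>S. int p dvd B (w - v) s - B s (w - v)})|"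
proof -
  have sub: "subgroup A G" and comm: "comm_group (G\<lparr>carrier := A\<rparr>)"
    using A by (auto simp: maximal_abelian_subgroup_def abelian_subgroup_def)
  show "v - w \<in> S" if vw: "v \<in> S" "w \<in> S" for v w
  proof -
    obtain a b where "mk v a \<in> A" "mk w b \<in> A"
      using vw by (auto simp: S_def)
    then have "mk v a \<otimes>\<^bsub>G\<^esub> inv\<^bsub>G\<^esub> (mk w b) \<in> A"
      using sub by (intro subgroup.m_closed subgroup.m_inv_closed)
    then show ?thesis
      by (auto simp: inv_mk S_def)
  qed
  show "N \<subseteq> S"
  proof
    fix v assume "v \<in> N"
    then show "v \<in> S"
      using subgroup.one_closed[OF sub] mk_null[of v 0] unfolding S_def one_mk by (metis mem_Collect_eq)
  qed
  show iso: "int p dvd B v w - B w v" if vw: "v \<in> S" "w \<in> S" for v w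
  proof -
    obtain a b where "mk v a \<in> A" "mk w b \<in> A"
      using vw by (auto simp: S_def)
    then have "mk v a \<otimes>\<^bsub>G\<^esub> mk w b = mk w b \<otimes>\<^bsub>G\<^esub> mk v a"
      using comm_monoid.m_comm[OF comm_group.axioms(1)[OF comm]] by (auto simp del: mult_mk)
    then show ?thesis
      unfolding mk_commute_iff .
  qed
  let ?perp = "\<lambda>v. {w. \<forall>s\<in>S. int p dvd B (w - v) s - B s (w - v)}"
  have perp: "mk v a \<in> A" if v: "\<And>s. s \<in> S \<Longrightarrow> int p dvd B v s - B s v" for v a
  proof (rule maximal_abelian_self_centralizing[OF A])
    fix x assume "x \<in> A"
    moreover from this obtain s b where "x = mk s b"
      using subgroup.subset[OF sub] carrierE by blast
    ultimately show "mk v a \<otimes>\<^bsub>G\<^esub> x = x \<otimes>\<^bsub>G\<^esub> mk v a"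
      using v[of s] mk_commute_iff by (auto simp: S_def)
  qed simp
  have coset: "A #>\<^bsub>G\<^esub> mk v a = {mk w b | w b. w \<in> ?perp v}" for v a
  proof (intro equalityI subsetI)
    fix x assume "x \<in> A #>\<^bsub>G\<^esub> mk v a"
    then obtain y where y: "y \<in> A" "x = y \<otimes>\<^bsub>G\<^esub> mk v a"
      by (auto simp: r_coset_def)
    then obtain s b where sb: "y = mk s b"
      using subgroup.subset[OF sub] carrierE by blast
    then have "s \<in> S"
      using y by (auto simp: S_def)
    then have "s + v \<in> ?perp v"
      using iso by simp
    then show "x \<in> {mk w b | w b. w \<in> ?perp v}"
      unfolding y(2) sb mult_mk by blast
  next
    fix x assume "x \<in> {mk w b | w b. w \<in> ?perp v}"
    then obtain w b where wb: "x = mk w b" "w \<in> ?perp v"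
      by blast
    have "mk (w - v) (b - a - B (w - v) v) \<in> A"
      using wb(2) by (intro perp) simp
    moreover have "x = mk (w - v) (b - a - B (w - v) v) \<otimes>\<^bsub>G\<^esub> mk v a"
      by (simp add: wb)
    ultimately show "x \<in> A #>\<^bsub>G\<^esub> mk v a"
      unfolding r_coset_def by blast
  qed
  have "rcosets\<^bsub>G\<^esub> A \<subseteq> (\<lambda>C. {mk w b | w b. w \<in> C}) ` range ?perp"
  proof
    fix X assume "X \<in> rcosets\<^bsub>G\<^esub> A"
    then obtain v a where "X = A #>\<^bsub>G\<^esub> mk v a"
      by (auto simp: RCOSETS_def elim!: carrierE)
    then show "X \<in> (\<lambda>C. {mk w b | w b. w \<in> C}) ` range ?perp"
      unfolding coset by blast
  qed
  then show "|rcosets\<^bsub>G\<^esub> A| \<le>o |range ?perp|"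
    by (rule ordLeq_transitive[OF card_of_mono1 card_of_image])
qed

end

section \<open>The group of a Kurepa tree\<close>

lemma lin_of_bool: "lin (\<lambda>i. of_bool (i = k)) v = lookup v k"
proof -
  have "lin (\<lambda>i. of_bool (i = k)) v = (\<Sum>i\<in>insert k (keys v). lookup v i * of_bool (i = k))"
    by (rule lin_superset) auto
  also have "\<dots> = (\<Sum>i\<in>insert k (keys v). if i = k then lookup v k else 0)"
    by (rule sum.cong) auto
  also have "\<dots> = lookup v k"
    by (subst sum.delta) auto
  finally show ?thesis .
qed

lemma red_eq_iff: "red p v = red p w \<longleftrightarrow> (\<forall>i. int p dvd lookup (v - w) i)"
  by (simp add: poly_mapping_eq_iff fun_eq_iff lookup_minus mod_eq_dvd_iff)

lemma infinite_Field_omega2: "infinite (Field omega2)"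
  and omega1_le_omega2: "omega1 \<le>o omega2"
proof -
  show le: "omega1 \<le>o omega2"
    using cardSuc_greater[OF Card_order_omega1] ordLess_imp_ordLeq by blast
  have "|UNIV :: ord1 set| \<le>o |Field omega2|"
    using ordIso_ordLeq_trans[OF card_of_ord1 le] card_of_Field_ordIso[OF Card_order_omega2]
      ordIso_symmetric ordLeq_ordIso_trans by blast
  then show "infinite (Field omega2)"
    using infinite_ord1 card_of_ordLeq_infinite by blast
qed

text \<open>The singletons make the form nondegenerate on \<open>U\<close>.\<close>

definition family :: "(ord2 \<Rightarrow> ord1 set) \<Rightarrow> ord1 + ord2 \<Rightarrow> ord1 set" where
  "family A = case_sum (\<lambda>\<gamma>. {\<gamma>}) A"

lemma family_simps [simp]: "family A (Inl \<gamma>) = {\<gamma>}" "family A (Inr k) = A k"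
  by (simp_all add: family_def)

text \<open>Canonical representatives: congruent names reduce to the same value. They model the
  carrier before it is transported to \<open>Field omega2\<close>.\<close>

definition reduce :: "nat \<Rightarrow> (ord1 \<Rightarrow>\<^sub>0 int) \<times> (ord1 + ord2 \<Rightarrow>\<^sub>0 int) \<Rightarrow> int \<Rightarrow>
    ((ord1 \<Rightarrow>\<^sub>0 int) \<times> (ord1 + ord2 \<Rightarrow>\<^sub>0 int)) \<times> int" where
  "reduce p v a = ((red p (fst v), red p (snd v)), a mod int p)"

text \<open>The upper bound counts finitely supported functions on index sets of size at most
  \<open>omega2\<close>; the unit vectors at \<open>Inr k\<close> stay distinct modulo
  \<open>p\<close> and give the lower bound.\<close>

lemma card_of_reduce:
  assumes "prime p"
  shows "|{reduce p v a | v a. True}| =o omega2"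
proof -
  have le: "|X| \<le>o omega2" if "|X| \<le>o omega1" for X :: "'x set"
    using that omega1_le_omega2 ordLeq_transitive by blast
  note times = card_of_Times_ordLeq_infinite_Field[OF infinite_Field_omega2 _ _ Card_order_omega2]
  have sum: "|UNIV :: (ord1 + ord2) set| \<le>o omega2"
  proof -
    have "|Sum_Type.Plus (UNIV :: ord1 set) (UNIV :: ord2 set)| \<le>o omega2"
      by (rule card_of_Plus_ordLeq_infinite_Field[OF infinite_Field_omega2 _ _ Card_order_omega2])
        (rule le ordIso_imp_ordLeq card_of_ord1 card_of_ord2)+
    then show ?thesis
      by simp
  qed
  have "infinite (UNIV :: (ord1 + ord2) set)"
    using infinite_ord1 by (metis finite_Plus_UNIV_iff)
  then have "|UNIV :: (ord1 + ord2 \<Rightarrow>\<^sub>0 int) set| \<le>o omega2"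
    using card_of_poly_mapping sum ordLeq_transitive by blast
  moreover have "|UNIV :: (ord1 \<Rightarrow>\<^sub>0 int) set| \<le>o omega2"
    using card_of_poly_mapping[OF infinite_ord1] card_of_ord1 le ordLeq_ordIso_trans by blast
  moreover have "|UNIV :: int set| \<le>o omega2"
    by (rule le) (use countable_iff_ordLess_omega1 ordLess_imp_ordLeq in blast)
  ultimately have "|((UNIV :: (ord1 \<Rightarrow>\<^sub>0 int) set) \<times> (UNIV :: (ord1 + ord2 \<Rightarrow>\<^sub>0 int) set)) \<times> (UNIV :: int set)| \<le>o omega2"
    by (intro times)
  then have "|{reduce p v a | v a. True}| \<le>o omega2"
    by (rule ordLeq_transitive[rotated]) (rule card_of_mono1, simp)
  moreover have "omega2 \<le>o |{reduce p v a | v a. True}|"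
  proof -
    define f where "f k = reduce p (0, Poly_Mapping.single (Inr k) 1) 0" for k
    have "inj f"
    proof (rule injI)
      fix k l
      assume "f k = f l"
      then have "red p (Poly_Mapping.single (Inr k :: ord1 + ord2) 1) = red p (Poly_Mapping.single (Inr l) 1)"
        by (simp add: f_def reduce_def)
      then have "lookup (red p (Poly_Mapping.single (Inr k :: ord1 + ord2) 1)) (Inr k) =
        lookup (red p (Poly_Mapping.single (Inr l) 1)) (Inr k)"
        by simp
      then show "k = l"
        using prime_gt_1_nat[OF assms] by (auto simp: lookup_single when_def split: if_splits)
    qed
    moreover have "range f \<subseteq> {reduce p v a | v a. True}"
      by (auto simp: f_def)
    ultimately have "|UNIV :: ord2 set| \<le>o |{reduce p v a | v a. True}|"
      using card_of_ordLeq by blast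
    then show ?thesis
      using card_of_ord2 ordIso_symmetric ordIso_ordLeq_trans by blast
  qed
  ultimately show ?thesis
    using ordIso_iff_ordLeq by blast
qed

text \<open>Cut at \<delta>, a singleton is empty or one of countably many; and countably many
  singletons lie below one countable ordinal. So adding them preserves both properties.\<close>

lemma kurepa_form_family:
  assumes "prime p" "strong_colouring p c"
    and traces: "\<And>\<delta>. countable (range (\<lambda>k. A k \<inter> {..<\<delta>}))"
    and disjoint: "\<And>F. countable F \<Longrightarrow> \<exists>\<gamma>. \<forall>k\<in>F. \<forall>l\<in>F. k \<noteq> l \<longrightarrow> A k \<inter> A l \<subseteq> {..<\<gamma>}"
  shows "kurepa_form p c (family A)"
proof
  fix \<delta>
  have "range (\<lambda>k. family A k \<inter> {..<\<delta>}) \<subseteq>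
    insert {} ((\<lambda>\<gamma>. {\<gamma>}) ` {..<\<delta>}) \<union> range (\<lambda>k. A k \<inter> {..<\<delta>})"
  proof (intro image_subsetI)
    fix k
    show "family A k \<inter> {..<\<delta>} \<in> insert {} ((\<lambda>\<gamma>. {\<gamma>}) ` {..<\<delta>}) \<union> range (\<lambda>k. A k \<inter> {..<\<delta>})"
      by (cases k) auto
  qed
  moreover have "countable (insert {} ((\<lambda>\<gamma>. {\<gamma>}) ` {..<\<delta>}) \<union> range (\<lambda>k. A k \<inter> {..<\<delta>}))"
    using traces by simp
  ultimately show "countable (range (\<lambda>k. family A k \<inter> {..<\<delta>}))"
    by (rule countable_subset)
next
  fix F :: "(ord1 + ord2) set"
  assume "countable F"
  have vimage: "countable (f -` F)" if "inj f" for f :: "'b \<Rightarrow> ord1 + ord2"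
    by (rule countable_image_inj_on[OF countable_subset[OF image_vimage_subset \<open>countable F\<close>]])
      (rule inj_on_subset[OF that subset_UNIV])
  have "countable (Inl -` F)" "countable (Inr -` F)"
    by (rule vimage, simp)+
  obtain \<gamma>1 where \<gamma>1: "\<And>\<gamma>. \<gamma> \<in> Inl -` F \<Longrightarrow> \<gamma> < \<gamma>1"
    using countable_bound_ord1[OF \<open>countable (Inl -` F)\<close>] by blast
  obtain \<gamma>2 where \<gamma>2: "\<forall>k\<in>Inr -` F. \<forall>l\<in>Inr -` F. k \<noteq> l \<longrightarrow> A k \<inter> A l \<subseteq> {..<\<gamma>2}"
    using disjoint[OF \<open>countable (Inr -` F)\<close>] by blast
  have "family A k \<inter> family A l \<subseteq> {..<max \<gamma>1 \<gamma>2}" if "k \<in> F" "l \<in> F" "k \<noteq> l" for k l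
  proof (cases k)
    case (Inl \<gamma>)
    then show ?thesis
      using \<gamma>1[of \<gamma>] that by (auto simp: less_max_iff_disj)
  next
    case k: (Inr i)
    show ?thesis
    proof (cases l)
      case (Inl \<gamma>)
      then show ?thesis
        using \<gamma>1[of \<gamma>] that by (auto simp: less_max_iff_disj)
    next
      case (Inr j)
      then have "A i \<inter> A j \<subseteq> {..<\<gamma>2}"
        using \<gamma>2 k that by simp
      then show ?thesis
        by (auto simp: k Inr less_max_iff_disj)
    qed
  qed
  then show "\<exists>\<gamma>. \<forall>k\<in>F. \<forall>l\<in>F. k \<noteq> l \<longrightarrow> family A k \<inter> family A l \<subseteq> {..<\<gamma>}"
    by blast
qed (use assms in auto)

lemma heisenberg_family:
  assumes form: "kurepa_form p c (family A)"
    and uncountable: "\<And>k. uncountable (A k)"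
    and inj: "inj_on h {reduce p v a | v a. True}"
  shows "heisenberg p (kurepa_form.form c (family A)) (kurepa_form.null p) (\<lambda>v a. h (reduce p v a))"
proof -
  interpret kurepa_form p c "family A"
    by (rule form)
  show ?thesis
  proof
    show "prime p"
      by (rule prime_p)
    fix v w v' w' n n' :: "(ord1 \<Rightarrow>\<^sub>0 int) \<times> (ord1 + ord2 \<Rightarrow>\<^sub>0 int)" and a b :: int
    show "form (v + v') w = form v w + form v' w" "form v (w + w') = form v w + form v w'"
      by (rule form_add_left form_add_right)+
    show "n \<in> null \<Longrightarrow> int p dvd form n w" "n \<in> null \<Longrightarrow> int p dvd form v n"
      by (rule dvd_form_left dvd_form_right, assumption)+
    show "n \<in> null \<Longrightarrow> n' \<in> null \<Longrightarrow> n - n' \<in> null"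
      by (simp add: null_def lookup_minus)
    have "h (reduce p v a) = h (reduce p w b) \<longleftrightarrow> reduce p v a = reduce p w b"
      using inj by (rule inj_on_eq_iff) blast+
    also have "\<dots> \<longleftrightarrow> v - w \<in> null \<and> int p dvd a - b"
      by (simp add: reduce_def red_eq_iff null_def mod_eq_dvd_iff)
    finally show "h (reduce p v a) = h (reduce p w b) \<longleftrightarrow> v - w \<in> null \<and> int p dvd a - b" .
    show "(\<Sum>i<p. v) \<in> null"
      by (simp add: null_def fst_sum snd_sum lookup_sum)
  next
    have "(Poly_Mapping.single undefined 1, 0) \<notin> null"
      using prime_gt_1_nat[OF prime_p] by (auto simp: null_def intro!: exI[of _ undefined])
    then show "\<exists>v. v \<notin> null"
      by blast
  next
    fix v :: "(ord1 \<Rightarrow>\<^sub>0 int) \<times> (ord1 + ord2 \<Rightarrow>\<^sub>0 int)"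
    assume perp: "\<And>w. int p dvd form v w - form w v"
    have fst: "int p dvd lookup (fst v) \<gamma>" for \<gamma>
    proof -
      have "(\<lambda>\<alpha>. ind \<alpha> (Inl \<gamma>)) = (\<lambda>\<alpha>. of_bool (\<alpha> = \<gamma>))"
        by (auto simp: ind_def)
      then have "form v (0, Poly_Mapping.single (Inl \<gamma>) 1) - form (0, Poly_Mapping.single (Inl \<gamma>) 1) v = - lookup (fst v) \<gamma>"
        by (simp add: form_def bil_def lin_of_bool)
      then show ?thesis
        using perp[of "(0, Poly_Mapping.single (Inl \<gamma>) 1)"] by simp
    qed
    \<comment> \<open>The first component is now zero modulo \<open>p\<close>, so pairing with the
      unit vector at \<alpha> leaves only the value of the second component at \<alpha>.\<close>
    have lin: "int p dvd lin (ind \<alpha>) (snd v)" for \<alpha>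
    proof -
      have "int p dvd (form v (Poly_Mapping.single \<alpha> 1, 0) - form (Poly_Mapping.single \<alpha> 1, 0) v)
        - bil c (fst v) (Poly_Mapping.single \<alpha> 1) + bil c (Poly_Mapping.single \<alpha> 1) (fst v)"
        by (rule dvd_add[OF dvd_diff[OF perp dvd_bil_left[OF fst]] dvd_bil_right[OF fst]])
      also have "\<dots> = lin (ind \<alpha>) (snd v)"
        by (simp add: form_def bil_def)
      finally show ?thesis .
    qed
    have Inr: "int p dvd lookup (snd v) (Inr k)" for k
    proof -
      have "countable (insert (Inr k) (keys (snd v)))"
        by (simp add: countable_finite)
      then obtain \<gamma> where \<gamma>: "\<And>i j. i \<in> insert (Inr k) (keys (snd v)) \<Longrightarrow> j \<in> insert (Inr k) (keys (snd v)) \<Longrightarrow>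
          i \<noteq> j \<Longrightarrow> family A i \<inter> family A j \<subseteq> {..<\<gamma>}"
        using eventually_disjoint by meson
      \<comment> \<open>The uncountable \<open>A k\<close> has a node \<alpha> beyond \<gamma>. It
        lies in no other set occurring in \<open>snd v\<close>, so evaluation at \<alpha> isolates
        the coefficient of \<open>Inr k\<close>.\<close>
      have "\<not> A k \<subseteq> {..<\<gamma>}"
        using uncountable countable_subset[OF _ countable_lessThan_ord1] by blast
      then obtain \<alpha> where \<alpha>: "\<alpha> \<in> A k" "\<not> \<alpha> < \<gamma>"
        by blast
      have "lin (ind \<alpha>) (snd v) = lin (\<lambda>i. of_bool (i = Inr k)) (snd v)"
      proof (rule lin_cong)
        fix i assume "i \<in> keys (snd v)"
        then show "ind \<alpha> i = of_bool (i = Inr k)"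
          using \<gamma>[of i "Inr k"] \<alpha> by (auto simp: ind_def)
      qed
      then show ?thesis
        using lin[of \<alpha>] by (simp add: lin_of_bool)
    qed
    have "int p dvd lookup (snd v) i" for i
    proof (cases i)
      case (Inl \<gamma>)
      \<comment> \<open>Modulo \<open>p\<close> only singleton indices remain, and only
        \<open>Inl \<gamma>\<close> contributes at the node \<gamma>.\<close>
      have "int p dvd lin (\<lambda>j. ind \<gamma> j - of_bool (j = i)) (snd v)"
        unfolding lin_def
      proof (rule dvd_sum)
        fix j
        show "int p dvd lookup (snd v) j * (ind \<gamma> j - of_bool (j = i))"
          using Inr by (cases j) (auto simp: ind_def Inl)
      qed
      then have "int p dvd lin (ind \<gamma>) (snd v) - lookup (snd v) i"
        by (simp add: lin_fun_diff lin_of_bool)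
      from dvd_diff[OF lin[of \<gamma>] this] show ?thesis
        by simp
    qed (use Inr in simp)
    then show "v \<in> null"
      using fst by (simp add: null_def)
  qed
qed

theorem theoremD:
  fixes p :: nat
  assumes "prime p"
    and "\<exists>T :: 'a rel. kurepa_tree T"
  shows "\<exists>G :: nat set set monoid.
           extraspecial p G \<and> |carrier G| =o omega2 \<and>
           (\<forall>A. maximal_abelian_subgroup A G \<longrightarrow> |rcosets\<^bsub>G\<^esub> A| \<le>o omega1)"
proof -
  obtain T :: "'a rel" where "kurepa_tree T"
    using assms(2) by blast
  then interpret kurepa T
    by unfold_locales
  obtain A :: "ord2 \<Rightarrow> ord1 set" where A: "\<And>k. uncountable (A k)"
    "\<And>\<delta>. countable (range (\<lambda>k. A k \<inter> {..<\<delta>}))"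
    "\<And>F. countable F \<Longrightarrow> \<exists>\<gamma>. \<forall>k\<in>F. \<forall>l\<in>F. k \<noteq> l \<longrightarrow> A k \<inter> A l \<subseteq> {..<\<gamma>}"
    using ex_kurepa_family by blast
  obtain c where "strong_colouring p c"
    using ex_strong_colouring[OF assms(1)] by blast
  then interpret kurepa_form p c "family A"
    using kurepa_form_family[OF assms(1) _ A(2,3)] by blast
  \<comment> \<open>The carrier is transported to \<open>Field omega2\<close>, because the group has
    to live on the type \<open>nat set set\<close>.\<close>
  have "|{reduce p v a | v a. True}| =o |Field omega2|"
    using card_of_reduce[OF assms(1)] card_of_Field_ordIso[OF Card_order_omega2]
      ordIso_symmetric ordIso_transitive by blast
  then obtain h where h: "bij_betw h {reduce p v a | v a. True} (Field omega2)"
    using card_of_ordIso by blast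
  interpret H: heisenberg p form null "\<lambda>v a. h (reduce p v a)"
    by (rule heisenberg_family[OF kurepa_form_axioms A(1) bij_betw_imp_inj_on[OF h]])
  have "carrier H.G = h ` {reduce p v a | v a. True}"
    unfolding H.G_def partial_object.simps by blast
  then have "carrier H.G = Field omega2"
    using bij_betw_imp_surj_on[OF h] by simp
  then have "|carrier H.G| =o omega2"
    using card_of_Field_ordIso[OF Card_order_omega2] by simp
  moreover have "|rcosets\<^bsub>H.G\<^esub> B| \<le>o omega1" if "maximal_abelian_subgroup B H.G" for B
    by (rule ordLeq_transitive[OF H.maximal_abelian_isotropic(4)[OF that]
          card_of_perp_cosets[unfolded alt_def, OF H.maximal_abelian_isotropic(1-3)[OF that]]])
  ultimately show ?thesis
    using H.extraspecial_G by blast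
qed

end
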